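(* Let $\Phi=\{\alpha+r\delta:\alpha\in\mathring\Phi,\ r\in\mathbb Z\}$ be an irreducible untwisted affine root system and let $\Psi$ be a maximal closed subroot system of $\Phi$. (1) If $\mathrm{Gr}(\Psi)=\mathring\Phi$, then there exist a $\mathbb Z$-linear function $p:\mathrm{Gr}(\Psi)\to\mathbb Z$, $\alpha\mapsto p_\alpha$, satisfying $p_\beta-\langle\beta,\alpha^\vee\rangle p_\alpha=p_{\mathbf s_\alpha(\beta)}$ for all $\alpha,\beta\in\mathrm{Gr}(\Psi)$, and a prime number $n_\Psi$ such that $$\Psi=\{\alpha+(p_\alpha+rn_\Psi)\delta:\alpha\in\mathrm{Gr}(\Psi),\ r\in\mathbb Z\}.$$ Conversely, given a $\mathbb Z$-linear function $p:\mathring\Phi\to\mathbb Z$ satisfying $p_\beta-\langle\beta,\alpha^\vee\rangle p_\alpha=p_{\mathbf s_\alpha(\beta)}$ for all $\alpha,\beta\in\mathring\Phi$ and a prime number $n$, the set $\{\alpha+(p_\alpha+rn)\delta:\alpha\in\mathring\Phi,\ r\in\mathbb Z\}$ is a maximal closed subroot system of $\Phi$. The affine type of such a $\Psi$ is the same as the affine type of $\Phi$. (2) If $\mathrm{Gr}(\Psi)\subsetneq\mathring\Phi$ is a maximal closed subroot system of $\mathring\Phi$, then $$\Psi=\{\alpha+r\delta:\alpha\in\mathrm{Gr}(\Psi),\ r\in\mathbb Z\}.$$ Conversely, if $\mathring\Psi$ is a proper maximal closed subroot system of $\mathring\Phi$, then the lift $\widehat{\mathring\Psi}=\{\alpha+r\delta:\alpha\in\mathring\Psi,\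 r\in\mathbb Z\}$ is a maximal closed subroot system of $\Phi$. The affine type of $\widehat{\mathring\Psi}$ is $X_n^{(1)}$ if $\mathring\Psi$ is of finite type $X_n$ (componentwise if $\mathring\Psi$ is reducible).
   Context: $\mathring\Phi$ is an irreducible reduced crystallographic finite root system in a Euclidean space with form $(\cdot,\cdot)$; $\delta$ is an additional vector, linearly independent of $\mathring\Phi$, with $(\delta,\cdot)=0$. $\Phi=\{\alpha+r\delta:\alpha\in\mathring\Phi,r\in\mathbb Z\}$ is the set of real roots of the untwisted affine Kac–Moody algebra attached to $\mathring\Phi$. For roots, $\langle\beta,\alpha^\vee\rangle=2(\beta,\alpha)/(\alpha,\alpha)$ and $\mathbf s_\alpha(\beta)=\beta-\langle\beta,\alpha^\vee\rangle\alpha$. A non-empty subset $\Psi$ of $R$ ($R=\Phi$ or $\mathring\Phi$) is a subroot system if $\mathbf s_\alpha(\beta)\in\Psi$ for all $\alpha,\beta\in\Psi$; it is closed if $\alpha,\beta\in\Psi$ and $\alpha+\beta\in R$ imply $\alpha+\beta\in\Psi$. A maximal closed subroot system of $R$ is a proper closed subroot system $\Psi$ such that $\Psi\subseteq\Delta\subsetneq R$ with $\Delta$ a closed subroot system implies $\Delta=\Psi$. The gradient of $\Psi\subseteq\Phi$ is $\mathrm{Gr}(\Psi)=\{\alpha\in\mathring\Phi:\alpha+r\delta\in\Psi\text{ for some }r\}$. A function $p:\Psi\to\mathbb Z$ on a finite root system is $\mathbb Z$-linear if it is the restriction of an additive homomorphism from the lattice spanned by $\Psi$. Type: an irreducible subroot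 system $\Psi$ of $\Phi$ is of type $X_n^{(r)}$ if there is a linear isomorphism from the real span of $\Psi$ onto the real span of the real affine root system of type $X_n^{(r)}$ mapping $\Psi$ onto it and preserving the integers $\langle\beta,\alpha^\vee\rangle$; a reducible one has type $\bigoplus_i X_{n_i}^{(r_i)}$ if it is the union of mutually orthogonal irreducible components of types $X_{n_i}^{(r_i)}$. $X_n^{(1)}$ is the untwisted affine type attached to the finite type $X_n$. *)

theory Defs
  imports "HOL-Analysis.Analysis" "HOL-Library.Multiset" "HOL-Computational_Algebra.Primes"
begin

text \<open>
  Root combinatorics is defined relative to a form \<open>B\<close>, so that the same notions apply to finite
  root systems in a Euclidean space (with its inner product) and to affine ones (with the
  degenerate form \<open>affine_form\<close> below).
\<close>

definition cartan_int :: "('v::real_vector \<Rightarrow> 'v \<Rightarrow> real) \<Rightarrow> 'v \<Rightarrow> 'v \<Rightarrow> real" where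
  "cartan_int B \<beta> \<alpha> = 2 * B \<beta> \<alpha> / B \<alpha> \<alpha>"

definition root_reflection :: "('v::real_vector \<Rightarrow> 'v \<Rightarrow> real) \<Rightarrow> 'v \<Rightarrow> 'v \<Rightarrow> 'v" where
  "root_reflection B \<alpha> \<beta> = \<beta> - cartan_int B \<beta> \<alpha> *\<^sub>R \<alpha>"

definition subroot_system :: "('v::real_vector \<Rightarrow> 'v \<Rightarrow> real) \<Rightarrow> 'v set \<Rightarrow> 'v set \<Rightarrow> bool" where
  "subroot_system B R \<Psi> \<longleftrightarrow>
     \<Psi> \<noteq> {} \<and> \<Psi> \<subseteq> R \<and> (\<forall>\<alpha>\<in>\<Psi>. \<forall>\<beta>\<in>\<Psi>. root_reflection B \<alpha> \<beta> \<in> \<Psi>)"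

definition closed_subroot_system :: "('v::real_vector \<Rightarrow> 'v \<Rightarrow> real) \<Rightarrow> 'v set \<Rightarrow> 'v set \<Rightarrow> bool" where
  "closed_subroot_system B R \<Psi> \<longleftrightarrow>
     subroot_system B R \<Psi> \<and> (\<forall>\<alpha>\<in>\<Psi>. \<forall>\<beta>\<in>\<Psi>. \<alpha> + \<beta> \<in> R \<longrightarrow> \<alpha> + \<beta> \<in> \<Psi>)"

definition maximal_closed_subroot_system ::
    "('v::real_vector \<Rightarrow> 'v \<Rightarrow> real) \<Rightarrow> 'v set \<Rightarrow> 'v set \<Rightarrow> bool" where
  "maximal_closed_subroot_system B R \<Psi> \<longleftrightarrow>
     closed_subroot_system B R \<Psi> \<and> \<Psi> \<noteq> R \<and>
     (\<forall>\<Delta>. closed_subroot_system B R \<Delta> \<longrightarrow> \<Psi> \<subseteq> \<Delta> \<longrightarrow> \<Delta> \<subset> R \<longrightarrow> \<Delta> = \<Psi>)"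

definition orthogonal_sets :: "('v \<Rightarrow> 'v \<Rightarrow> real) \<Rightarrow> 'v set \<Rightarrow> 'v set \<Rightarrow> bool" where
  "orthogonal_sets B P Q \<longleftrightarrow> (\<forall>\<alpha>\<in>P. \<forall>\<beta>\<in>Q. B \<alpha> \<beta> = 0)"

definition irreducible_roots :: "('v \<Rightarrow> 'v \<Rightarrow> real) \<Rightarrow> 'v set \<Rightarrow> bool" where
  "irreducible_roots B R \<longleftrightarrow>
     R \<noteq> {} \<and> \<not> (\<exists>P Q. P \<noteq> {} \<and> Q \<noteq> {} \<and> P \<inter> Q = {} \<and> P \<union> Q = R \<and> orthogonal_sets B P Q)"


subsection \<open>Finite root systems\<close>

text \<open>Reduced crystallographic root systems; they need not span the ambient Euclidean space.\<close>

definition finite_root_system :: "'a::euclidean_space set \<Rightarrow> bool" where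
  "finite_root_system R \<longleftrightarrow>
     finite R \<and> 0 \<notin> R \<and>
     (\<forall>\<alpha>\<in>R. \<forall>\<beta>\<in>R. root_reflection (\<bullet>) \<alpha> \<beta> \<in> R) \<and>
     (\<forall>\<alpha>\<in>R. \<forall>\<beta>\<in>R. cartan_int (\<bullet>) \<beta> \<alpha> \<in> \<int>) \<and>
     (\<forall>\<alpha>\<in>R. \<forall>c. c *\<^sub>R \<alpha> \<in> R \<longrightarrow> c = 1 \<or> c = -1)"

definition root_lattice :: "'a::real_vector set \<Rightarrow> 'a set" where
  "root_lattice R = range (\<lambda>c::'a \<Rightarrow> int. \<Sum>\<alpha>\<in>R. of_int (c \<alpha>) *\<^sub>R \<alpha>)"

definition Z_linear_on :: "'a::real_vector set \<Rightarrow> ('a \<Rightarrow> int) \<Rightarrow> bool" where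
  "Z_linear_on R p \<longleftrightarrow>
     (\<exists>h. (\<forall>x\<in>root_lattice R. \<forall>y\<in>root_lattice R. h (x + y) = h x + h y) \<and> (\<forall>\<alpha>\<in>R. p \<alpha> = h \<alpha>))"

definition reflection_compatible :: "'a::euclidean_space set \<Rightarrow> ('a \<Rightarrow> int) \<Rightarrow> bool" where
  "reflection_compatible R p \<longleftrightarrow>
     (\<forall>\<alpha>\<in>R. \<forall>\<beta>\<in>R. real_of_int (p \<beta>) - cartan_int (\<bullet>) \<beta> \<alpha> * real_of_int (p \<alpha>) =
                     real_of_int (p (root_reflection (\<bullet>) \<alpha> \<beta>)))"


subsection \<open>Affine root systems\<close>

text \<open>
  The space spanned by a Euclidean space and \<open>\<delta>\<close> is \<open>'a \<times> real\<close>: the pair \<open>(v, t)\<close> stands for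
  \<open>v + t\<delta>\<close>, so \<open>\<delta> = (0, 1)\<close>, which is in the radical of the form.
\<close>

definition affine_form :: "'a::euclidean_space \<times> real \<Rightarrow> 'a \<times> real \<Rightarrow> real" where
  "affine_form x y = fst x \<bullet> fst y"

definition affine_lift :: "'a::euclidean_space set \<Rightarrow> ('a \<times> real) set" where
  "affine_lift R = {(\<alpha>, of_int r) | \<alpha> (r::int). \<alpha> \<in> R}"

definition gradient :: "'a::euclidean_space set \<Rightarrow> ('a \<times> real) set \<Rightarrow> 'a set" where
  "gradient R \<Psi> = {\<alpha> \<in> R. \<exists>r::int. (\<alpha>, of_int r) \<in> \<Psi>}"

definition shifted_lift :: "'a::euclidean_space set \<Rightarrow> ('a \<Rightarrow> int) \<Rightarrow> nat \<Rightarrow> ('a \<times> real) set" where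
  "shifted_lift R p n = {(\<alpha>, of_int (p \<alpha> + r * int n)) | \<alpha> (r::int). \<alpha> \<in> R}"


subsection \<open>Finite types\<close>

datatype cartan_type = An nat | Bn nat | Cn nat | Dn nat | En nat | F4 | G2

fun type_rank :: "cartan_type \<Rightarrow> nat" where
  "type_rank (An n) = n"
| "type_rank (Bn n) = n"
| "type_rank (Cn n) = n"
| "type_rank (Dn n) = n"
| "type_rank (En n) = n"
| "type_rank F4 = 4"
| "type_rank G2 = 2"

text \<open>The usual bounds, under which no two names denote the same Dynkin diagram.\<close>

fun valid_type :: "cartan_type \<Rightarrow> bool" where
  "valid_type (An n) \<longleftrightarrow> n \<ge> 1"
| "valid_type (Bn n) \<longleftrightarrow> n \<ge> 2"
| "valid_type (Cn n) \<longleftrightarrow> n \<ge> 3"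
| "valid_type (Dn n) \<longleftrightarrow> n \<ge> 4"
| "valid_type (En n) \<longleftrightarrow> n \<in> {6, 7, 8}"
| "valid_type F4 \<longleftrightarrow> True"
| "valid_type G2 \<longleftrightarrow> True"

definition chain_bond :: "nat \<Rightarrow> nat \<Rightarrow> int" where
  "chain_bond i j = (if i + 1 = j \<or> j + 1 = i then 1 else 0)"

text \<open>
  \<open>bond X i j\<close> is the negative of the Cartan integer of the \<open>i\<close>-th simple root against the coroot
  of the \<open>j\<close>-th one, for \<open>i \<noteq> j\<close>. The numbering is Bourbaki's, shifted to start at 0. A value
  above 1 means that the \<open>i\<close>-th simple root is the longer one.
\<close>

fun bond :: "cartan_type \<Rightarrow> nat \<Rightarrow> nat \<Rightarrow> int" where
  "bond (An n) i j = chain_bond i j"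
| "bond (Bn n) i j = (if i + 2 = n \<and> j + 1 = n then 2 else chain_bond i j)"
| "bond (Cn n) i j = (if i + 1 = n \<and> j + 2 = n then 2 else chain_bond i j)"
| "bond (Dn n) i j =
     (if {i, j} = {n - 3, n - 1} then 1
      else if {i, j} = {n - 2, n - 1} then 0
      else chain_bond i j)"
| "bond (En n) i j =
     (if {i, j} = {0, 2} \<or> {i, j} = {1, 3} then 1
      else if {i, j} = {0, 1} \<or> {i, j} = {1, 2} then 0
      else chain_bond i j)"
| "bond F4 i j = (if i = 1 \<and> j = 2 then 2 else chain_bond i j)"
| "bond G2 i j = (if i = 1 \<and> j = 0 then 3 else chain_bond i j)"

definition cartan_matrix :: "cartan_type \<Rightarrow> nat \<Rightarrow> nat \<Rightarrow> int" where
  "cartan_matrix X i j = (if i = j then 2 else - bond X i j)"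

definition root_base :: "'a::euclidean_space set \<Rightarrow> nat \<Rightarrow> (nat \<Rightarrow> 'a) \<Rightarrow> bool" where
  "root_base R n a \<longleftrightarrow>
     inj_on a {..<n} \<and> a ` {..<n} \<subseteq> R \<and> independent (a ` {..<n}) \<and>
     (\<forall>\<beta>\<in>R. \<exists>c::nat \<Rightarrow> nat. \<beta> = (\<Sum>i<n. real (c i) *\<^sub>R a i) \<or> \<beta> = - (\<Sum>i<n. real (c i) *\<^sub>R a i))"

definition irreducible_finite_type :: "'a::euclidean_space set \<Rightarrow> cartan_type \<Rightarrow> bool" where
  "irreducible_finite_type R X \<longleftrightarrow>
     finite_root_system R \<and> valid_type X \<and>
     (\<exists>a. root_base R (type_rank X) a \<and>
          (\<forall>i<type_rank X. \<forall>j<type_rank X.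
             cartan_int (\<bullet>) (a i) (a j) = of_int (cartan_matrix X i j)))"


subsection \<open>Affine types\<close>

definition short_roots :: "'a::euclidean_space set \<Rightarrow> 'a set" where
  "short_roots R = {\<alpha> \<in> R. \<forall>\<beta>\<in>R. norm \<alpha> \<le> norm \<beta>}"

definition twisted_lift :: "'a::euclidean_space set \<Rightarrow> nat \<Rightarrow> ('a \<times> real) set" where
  "twisted_lift R m =
     {(\<alpha>, of_int r) | \<alpha> (r::int). \<alpha> \<in> short_roots R} \<union>
     {(\<alpha>, of_int (r * int m)) | \<alpha> (r::int). \<alpha> \<in> R - short_roots R}"

text \<open>
  \<open>real_affine_roots X m S\<close>: \<open>S\<close> is the set of real roots of the affine algebra with Kac label
  \<open>X\<close> and superscript \<open>m\<close>, built from a finite root system \<open>R\<close>. For \<open>A\<close> with index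
  \<open>2l\<close> and superscript 2, Kac starts from a root system of type \<open>C\<close> with roots
  \<open>\<plusminus>\<epsilon>\<^sub>i \<plusminus> \<epsilon>\<^sub>j\<close>, \<open>\<plusminus>2\<epsilon>\<^sub>i\<close>; its halved long roots occur with odd multiples of \<open>\<delta>/2\<close>. Applying
  the linear map that fixes \<open>\<delta>\<close> and sends each \<open>\<epsilon>\<^sub>i\<close> to \<open>\<epsilon>\<^sub>i + \<delta>/2\<close> gives the description used here,
  where \<open>R\<close> has type \<open>B\<close> and short roots \<open>\<plusminus>\<epsilon>\<^sub>i\<close>.
  In a twisted label the index need not satisfy the bounds for finite types (\<open>Dn 3\<close> with
  superscript 2 is allowed).
\<close>

inductive real_affine_roots :: "cartan_type \<Rightarrow> nat \<Rightarrow> ('a::euclidean_space \<times> real) set \<Rightarrow> bool" where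
  untwisted: "irreducible_finite_type R X \<Longrightarrow> real_affine_roots X 1 (affine_lift R)"
| A_even: "l \<ge> 1 \<Longrightarrow> irreducible_finite_type R (if l = 1 then An 1 else Bn l) \<Longrightarrow>
     real_affine_roots (An (2 * l)) 2
       (affine_lift R \<union> {(2 *\<^sub>R \<alpha>, of_int (2 * r + 1)) | \<alpha> (r::int). \<alpha> \<in> short_roots R})"
| A_odd: "l \<ge> 3 \<Longrightarrow> irreducible_finite_type R (Cn l) \<Longrightarrow>
     real_affine_roots (An (2 * l - 1)) 2 (twisted_lift R 2)"
| D_twisted: "l \<ge> 2 \<Longrightarrow> irreducible_finite_type R (Bn l) \<Longrightarrow>
     real_affine_roots (Dn (l + 1)) 2 (twisted_lift R 2)"
| E6_twisted: "irreducible_finite_type R F4 \<Longrightarrow> real_affine_roots (En 6) 2 (twisted_lift R 2)"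
| D4_triality: "irreducible_finite_type R G2 \<Longrightarrow> real_affine_roots (Dn 4) 3 (twisted_lift R 3)"

definition affine_roots_iso ::
    "('a::euclidean_space \<times> real) set \<Rightarrow> ('a \<times> real) set \<Rightarrow> bool" where
  "affine_roots_iso \<Psi> S \<longleftrightarrow>
     (\<exists>f. linear f \<and> bij_betw f (span \<Psi>) (span S) \<and> f ` \<Psi> = S \<and>
          (\<forall>\<alpha>\<in>\<Psi>. \<forall>\<beta>\<in>\<Psi>. cartan_int affine_form (f \<beta>) (f \<alpha>) = cartan_int affine_form \<beta> \<alpha>))"

text \<open>
  The model \<open>S\<close> is sought in the ambient space of \<open>\<Psi>\<close>. This loses nothing: the dimension of the
  span of \<open>\<Psi>\<close> bounds the rank of the finite root system underlying \<open>S\<close>, which therefore has a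
  copy in \<open>'a\<close>.
\<close>

definition irreducible_affine_type ::
    "('a::euclidean_space \<times> real) set \<Rightarrow> cartan_type \<times> nat \<Rightarrow> bool" where
  "irreducible_affine_type \<Psi> T \<longleftrightarrow>
     (\<exists>S. real_affine_roots (fst T) (snd T) S \<and> affine_roots_iso \<Psi> S)"


subsection \<open>Types of possibly reducible systems\<close>

text \<open>
  A direct sum of types is encoded as the multiset of the types of the irreducible components.
\<close>

definition componentwise_type ::
    "('v \<Rightarrow> 'v \<Rightarrow> real) \<Rightarrow> ('v set \<Rightarrow> 't \<Rightarrow> bool) \<Rightarrow> 'v set \<Rightarrow> 't multiset \<Rightarrow> bool" where
  "componentwise_type B is_type \<Psi> M \<longleftrightarrow>
     (\<exists>\<C> t. finite \<C> \<and> \<Union>\<C> = \<Psi> \<and> pairwise (orthogonal_sets B) \<C> \<and>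
            (\<forall>C\<in>\<C>. irreducible_roots B C \<and> is_type C (t C)) \<and>
            M = image_mset t (mset_set \<C>))"

definition has_finite_type :: "'a::euclidean_space set \<Rightarrow> cartan_type multiset \<Rightarrow> bool" where
  "has_finite_type = componentwise_type (\<bullet>) irreducible_finite_type"

definition has_affine_type ::
    "('a::euclidean_space \<times> real) set \<Rightarrow> (cartan_type \<times> nat) multiset \<Rightarrow> bool" where
  "has_affine_type = componentwise_type affine_form irreducible_affine_type"

end

theory Submission
  imports Defs
begin

text \<open>
  Let \<open>\<Delta>\<close> be a closed subroot system of the affine lift of \<open>R\<close>, and over each root \<open>\<alpha>\<close> consider the
  set of integers \<open>r\<close> with \<open>\<alpha> + r\<delta> \<in> \<Delta>\<close>. If all these sets are non-empty, then they are cosets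
  \<open>p \<alpha> + m\<int>\<close> of one and the same subgroup, with a linear \<open>p\<close>. There are two reasons.

  First, a system of simple roots is linearly independent, so a choice of one integer over each
  simple root extends to a linear function \<open>f\<close>. A positive root that is not simple is a sum of two
  smaller positive roots, so closedness carries the section \<open>\<alpha> \<mapsto> \<alpha> + f(\<alpha>)\<delta>\<close> from the simple roots
  to the positive ones, and reflections carry it to the negative ones (\<open>ex_linear_section\<close>).

  Secondly, subtract this section. What remains over \<open>\<alpha>\<close> is a set \<open>Z \<alpha>\<close> of integers that contains 0
  and is closed under \<open>s \<mapsto> 2r - s\<close>, because the reflection in \<open>\<alpha> + r\<delta>\<close> maps
  \<open>\<alpha> + s\<delta>\<close> to the negative of \<open>\<alpha> + (2r - s)\<delta>\<close>; so \<open>Z \<alpha>\<close> is a subgroup of \<open>\<int>\<close>. If \<open>\<gamma>\<close> and \<open>\<beta>\<close>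
  are distinct roots at an acute angle, then \<open>\<gamma> - \<beta>\<close> is a root, and adding \<open>\<beta> + r\<delta>\<close> to the section
  over \<open>\<gamma> - \<beta>\<close> gives \<open>Z \<beta> \<subseteq> Z \<gamma>\<close>. By symmetry and irreducibility all \<open>Z \<alpha>\<close> coincide
  (\<open>eq_shifted_lift_of_section\<close>).

  Hence the closed subroot systems with full gradient that contain a given section \<open>p\<close> are the
  \<open>shifted_lift R p m\<close>, ordered by divisibility of \<open>m\<close>, and the maximal proper ones are those
  with \<open>m\<close> prime. When \<open>\<Delta>\<close> contains all of \<open>\<alpha> + \<int>\<delta>\<close> for a single root \<open>\<alpha>\<close>, full gradient forces
  \<open>m = 1\<close>. So no proper closed system with full gradient contains the lift of a non-empty set, and
  maximality of a lift reduces to maximality in \<open>R\<close>.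

  For the types, the linear automorphism \<open>v + t\<delta> \<mapsto> v + (f(v) + mt)\<delta>\<close> preserves the form and maps
  the affine lift onto \<open>shifted_lift R p m\<close>. For a given \<open>\<int>\<close>-linear \<open>p\<close> this needs a real-linear
  extension \<open>f\<close>, which is obtained by averaging over the coroots (\<open>Z_linear_on_extends_linear\<close>).
\<close>

section \<open>Finite root systems\<close>

lemma uminus_root:
  assumes "finite_root_system R" "\<alpha> \<in> R"
  shows "- \<alpha> \<in> R"
proof -
  have "root_reflection (\<bullet>) \<alpha> \<alpha> \<in> R" "\<alpha> \<noteq> 0"
    using assms by (auto simp: finite_root_system_def)
  then show ?thesis
    by (simp add: root_reflection_def cartan_int_def scaleR_2)
qed

lemma cartan_int_Ints:
  assumes "finite_root_system R" "\<alpha> \<in> R" "\<beta> \<in> R"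
  shows "cartan_int (\<bullet>) \<beta> \<alpha> \<in> \<int>"
  using assms by (auto simp: finite_root_system_def)

lemma root_reflection_in_roots:
  assumes "finite_root_system R" "\<alpha> \<in> R" "\<beta> \<in> R"
  shows "root_reflection (\<bullet>) \<alpha> \<beta> \<in> R"
  using assms by (auto simp: finite_root_system_def)

text \<open>
  The product of the two Cartan integers of \<open>\<alpha>\<close> and \<open>\<beta>\<close> is four times the square of a cosine. Both
  are positive, and strict Cauchy--Schwarz makes the product less than 4, so one of them is 1. The
  corresponding reflection subtracts one root from the other.
\<close>

lemma diff_root_of_acute:
  assumes R: "finite_root_system R" and a: "\<alpha> \<in> R" and b: "\<beta> \<in> R"
    and pos: "\<alpha> \<bullet> \<beta> > 0" and ne: "\<alpha> \<noteq> \<beta>"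
  shows "\<alpha> - \<beta> \<in> R"
proof -
  have nz: "\<alpha> \<noteq> 0" "\<beta> \<noteq> 0"
    using R a b by (auto simp: finite_root_system_def)
  \<comment> \<open>Equality would make the roots positively proportional, hence equal in a reduced system.\<close>
  have lt: "\<alpha> \<bullet> \<beta> < norm \<alpha> * norm \<beta>"
  proof (rule ccontr)
    assume "\<not> ?thesis"
    then have "\<alpha> \<bullet> \<beta> = norm \<alpha> * norm \<beta>"
      using norm_cauchy_schwarz[of \<alpha> \<beta>] by linarith
    then have eq: "norm \<alpha> *\<^sub>R \<beta> = norm \<beta> *\<^sub>R \<alpha>"
      by (simp add: norm_cauchy_schwarz_eq)
    then have "(1 / norm \<alpha>) *\<^sub>R (norm \<alpha> *\<^sub>R \<beta>) = (1 / norm \<alpha>) *\<^sub>R (norm \<beta> *\<^sub>R \<alpha>)"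
      by simp
    then have 1: "\<beta> = (norm \<beta> / norm \<alpha>) *\<^sub>R \<alpha>"
      using nz by simp
    moreover have "(norm \<beta> / norm \<alpha>) *\<^sub>R \<alpha> \<in> R \<longrightarrow>
        norm \<beta> / norm \<alpha> = 1 \<or> norm \<beta> / norm \<alpha> = -1"
      using R a unfolding finite_root_system_def by blast
    moreover have "norm \<beta> / norm \<alpha> > 0"
      using nz by simp
    ultimately have "norm \<beta> / norm \<alpha> = 1"
      using b by fastforce
    with 1 ne show False by simp
  qed
  obtain m where m: "cartan_int (\<bullet>) \<alpha> \<beta> = of_int m"
    using cartan_int_Ints[OF R b a] by (auto elim: Ints_cases)
  obtain n where n: "cartan_int (\<bullet>) \<beta> \<alpha> = of_int n"
    using cartan_int_Ints[OF R a b] by (auto elim: Ints_cases)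
  have "real_of_int m > 0" "real_of_int n > 0"
    using pos nz unfolding m[symmetric] n[symmetric] cartan_int_def by (simp_all add: inner_commute)
  then have mn: "m > 0" "n > 0" by simp_all
  have "real_of_int (m * n) = 4 * (\<alpha> \<bullet> \<beta>)\<^sup>2 / (norm \<alpha> * norm \<beta>)\<^sup>2"
    unfolding of_int_mult m[symmetric] n[symmetric] cartan_int_def
    by (simp add: inner_commute power2_norm_eq_inner power_mult_distrib) (simp add: power2_eq_square)
  also have "\<dots> < 4"
    using power_strict_mono[OF lt, of 2] pos nz by (simp add: field_simps)
  finally have lt4: "m * n < 4"
    by linarith
  have "m = 1 \<or> n = 1"
  proof (rule ccontr)
    assume "\<not> ?thesis"
    then have "m \<ge> 2" "n \<ge> 2" using mn by auto
    then have "2 * 2 \<le> m * n" by (intro mult_mono) auto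
    with lt4 show False by simp
  qed
  then show ?thesis
  proof
    assume "m = 1"
    then show ?thesis
      using root_reflection_in_roots[OF R b a] m by (simp add: root_reflection_def)
  next
    assume "n = 1"
    then have "\<beta> - \<alpha> \<in> R"
      using root_reflection_in_roots[OF R a b] n by (simp add: root_reflection_def)
    from uminus_root[OF R this] show ?thesis by simp
  qed
qed

text \<open>
  The roots where \<open>g\<close> takes a given value are orthogonal to all the others, so they are all the roots.
\<close>

lemma irreducible_roots_constant:
  assumes irr: "irreducible_roots B R"
    and step: "\<And>\<alpha> \<beta>. \<alpha> \<in> R \<Longrightarrow> \<beta> \<in> R \<Longrightarrow> B \<alpha> \<beta> \<noteq> 0 \<Longrightarrow> g \<alpha> = g \<beta>"
    and a: "\<alpha> \<in> R" and b: "\<beta> \<in> R"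
  shows "g \<alpha> = g \<beta>"
proof (rule ccontr)
  assume ne: "g \<alpha> \<noteq> g \<beta>"
  let ?P = "{\<gamma> \<in> R. g \<gamma> = g \<alpha>}" and ?Q = "{\<gamma> \<in> R. g \<gamma> \<noteq> g \<alpha>}"
  have "orthogonal_sets B ?P ?Q"
    using step unfolding orthogonal_sets_def by (metis (mono_tags, lifting) mem_Collect_eq)
  moreover have "?P \<noteq> {}" "?Q \<noteq> {}" "?P \<inter> ?Q = {}" "?P \<union> ?Q = R"
    using a b ne by auto
  ultimately have "\<exists>P Q. P \<noteq> {} \<and> Q \<noteq> {} \<and> P \<inter> Q = {} \<and> P \<union> Q = R \<and> orthogonal_sets B P Q"
    by (intro exI[of _ ?P] exI[of _ ?Q] conjI)
  with irr show False
    unfolding irreducible_roots_def by (elim conjE notE)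
qed

text \<open>
  The reason why simple roots are linearly independent. In a linear relation, move the terms with
  negative coefficients to the other side. Both sides are then the same vector \<open>x\<close>, and expanding
  \<open>x \<bullet> x\<close> as the product of the two sides shows \<open>x \<bullet> x \<le> 0\<close>. So \<open>x = 0\<close>, and pairing with \<open>v\<close>
  forces every coefficient on either side to vanish.
\<close>

lemma independent_if_obtuse_in_half_space:
  fixes S :: "'a::euclidean_space set"
  assumes fin: "finite S" and half: "\<And>s. s \<in> S \<Longrightarrow> v \<bullet> s > 0"
    and obtuse: "\<And>s t. s \<in> S \<Longrightarrow> t \<in> S \<Longrightarrow> s \<noteq> t \<Longrightarrow> s \<bullet> t \<le> 0"
  shows "independent S"
proof -
  have "\<forall>s\<in>S. c s = 0" if c: "(\<Sum>s\<in>S. c s *\<^sub>R s) = 0" for c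
  proof -
    let ?P = "{s \<in> S. c s > 0}" and ?N = "{s \<in> S. c s < 0}"
    define x where "x = (\<Sum>s\<in>?P. c s *\<^sub>R s)"
    define y where "y = (\<Sum>s\<in>?N. (- c s) *\<^sub>R s)"
    have "(\<Sum>s\<in>S. c s *\<^sub>R s) = (\<Sum>s\<in>?P \<union> ?N. c s *\<^sub>R s)"
      by (rule sum.mono_neutral_right) (use fin in auto)
    also have "\<dots> = x - y"
      unfolding x_def y_def using fin by (subst sum.union_disjoint) (auto simp: sum_negf)
    finally have xy: "x = y" using c by simp
    have "x \<bullet> y = (\<Sum>s\<in>?P. \<Sum>t\<in>?N. (c s * - c t) * (s \<bullet> t))"
      unfolding x_def y_def inner_sum_left inner_sum_right by (subst sum.swap) (simp add: mult_ac)
    also have "\<dots> \<le> 0"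
      by (intro sum_nonpos mult_nonneg_nonpos) (auto intro!: obtuse mult_nonneg_nonneg simp: mult_le_0_iff)
    finally have x0: "x = 0"
      using xy by (metis inner_eq_zero_iff inner_ge_zero order_antisym)
    have "(\<Sum>s\<in>?P. c s * (v \<bullet> s)) = v \<bullet> x" "(\<Sum>s\<in>?N. (- c s) * (v \<bullet> s)) = v \<bullet> y"
      unfolding x_def y_def inner_sum_right by simp_all
    then have sums: "(\<Sum>s\<in>?P. c s * (v \<bullet> s)) = 0" "(\<Sum>s\<in>?N. (- c s) * (v \<bullet> s)) = 0"
      using x0 xy by simp_all
    have "\<forall>s\<in>?P. c s * (v \<bullet> s) = 0"
      using sums(1) by (subst (asm) sum_nonneg_eq_0_iff) (use fin half in \<open>auto intro: less_imp_le\<close>)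
    moreover have "\<forall>s\<in>?N. (- c s) * (v \<bullet> s) = 0"
      using sums(2) by (subst (asm) sum_nonneg_eq_0_iff)
        (use fin half in \<open>auto intro: less_imp_le simp: mult_le_0_iff\<close>)
    ultimately show ?thesis
      using half by (metis (mono_tags, lifting) less_irrefl linorder_neqE_linordered_idom
          mem_Collect_eq mult_eq_0_iff neg_equal_0_iff_equal)
  qed
  then show ?thesis
    using fin independent_explicit by blast
qed

text \<open>
  Finitely many hyperplanes do not cover the space, as each of them has measure zero.
\<close>

lemma ex_regular_vector:
  fixes R :: "'a::euclidean_space set"
  assumes "finite R" "0 \<notin> R"
  shows "\<exists>v. \<forall>\<alpha>\<in>R. v \<bullet> \<alpha> \<noteq> 0"
proof (rule ccontr)
  assume "\<not> ?thesis"
  then have "UNIV = \<Union> ((\<lambda>\<alpha>. {x. \<alpha> \<bullet> x = 0}) ` R)"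
    by (auto simp: inner_commute)
  moreover have "negligible (\<Union> ((\<lambda>\<alpha>. {x. \<alpha> \<bullet> x = 0}) ` R))"
    using assms by (intro negligible_Union) (auto intro!: negligible_hyperplane)
  ultimately show False
    using non_negligible_UNIV by metis
qed

section \<open>Linear extension of integer-valued functions on the roots\<close>

text \<open>
  Consequently \<open>\<Sum>\<alpha>\<in>R. c \<alpha> * p \<alpha>\<close> depends only on the vector \<open>\<Sum>\<alpha>\<in>R. c \<alpha> *\<^sub>R \<alpha>\<close>; this is the
  form in which \<open>\<int>\<close>-linearity is applied.
\<close>

lemma Z_linear_on_sum:
  fixes R :: "'a::euclidean_space set"
  assumes fin: "finite R" and p: "Z_linear_on R p"
  shows "\<exists>h. \<forall>c::'a \<Rightarrow> int. h (\<Sum>\<alpha>\<in>R. of_int (c \<alpha>) *\<^sub>R \<alpha>) = (\<Sum>\<alpha>\<in>R. c \<alpha> * p \<alpha>)"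
proof -
  obtain h where add: "\<And>x y. x \<in> root_lattice R \<Longrightarrow> y \<in> root_lattice R \<Longrightarrow> h (x + y) = h x + h y"
    and hp: "\<And>\<alpha>. \<alpha> \<in> R \<Longrightarrow> p \<alpha> = h \<alpha>"
    using p unfolding Z_linear_on_def by blast
  have partial: "(\<Sum>\<alpha>\<in>A. of_int (c \<alpha>) *\<^sub>R \<alpha>) \<in> root_lattice R" if "A \<subseteq> R" for A and c :: "'a \<Rightarrow> int"
  proof -
    have "(\<Sum>\<alpha>\<in>A. of_int (c \<alpha>) *\<^sub>R \<alpha>) = (\<Sum>\<alpha>\<in>R. of_int (if \<alpha> \<in> A then c \<alpha> else 0) *\<^sub>R \<alpha>)"
      by (rule sum.mono_neutral_cong_left) (use that fin in auto)
    then show ?thesis unfolding root_lattice_def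
      by (rule range_eqI[where x = "\<lambda>\<alpha>. if \<alpha> \<in> A then c \<alpha> else 0"])
  qed
  have h0: "h 0 = 0"
    using add[of 0 0] partial[of "{}"] by simp
  have mult_mem: "of_int k *\<^sub>R \<alpha> \<in> root_lattice R" if "\<alpha> \<in> R" for k :: int and \<alpha>
    using partial[of "{\<alpha>}" "\<lambda>_. k"] that by simp
  have mult: "h (of_int k *\<^sub>R \<alpha>) = k * h \<alpha>" if a: "\<alpha> \<in> R" for k :: int and \<alpha>
  proof (induction k rule: int_induct[where k = 0])
    case base
    then show ?case using h0 by simp
  next
    case (step1 i)
    then show ?case
      using add[OF mult_mem[OF a, of i] mult_mem[OF a, of 1]] by (simp add: algebra_simps)
  next
    case (step2 i)
    then show ?case
      using add[OF mult_mem[OF a, of "i - 1"] mult_mem[OF a, of 1]] by (simp add: algebra_simps)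
  qed
  have "h (\<Sum>\<alpha>\<in>A. of_int (c \<alpha>) *\<^sub>R \<alpha>) = (\<Sum>\<alpha>\<in>A. c \<alpha> * p \<alpha>)" if "A \<subseteq> R" for A and c :: "'a \<Rightarrow> int"
    using finite_subset[OF that fin] that
  proof (induction A rule: finite_induct)
    case empty
    then show ?case using h0 by simp
  next
    case (insert \<alpha> A)
    then show ?case
      using add[OF mult_mem[of \<alpha> "c \<alpha>"] partial[of A c]] mult[of \<alpha> "c \<alpha>"] hp[of \<alpha>] by simp
  qed
  then show ?thesis by blast
qed

text \<open>
  The operator \<open>x \<mapsto> \<Sum>\<alpha>\<in>R. cartan_int (\<bullet>) x \<alpha> *\<^sub>R \<alpha>\<close> commutes with the reflections, hence maps \<open>\<beta>\<close> into the
  \<open>(-1)\<close>-eigenspace of the reflection in \<open>\<beta>\<close>, the line through \<open>\<beta>\<close>. Reindexing the sum by this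
  reflection also gives the eigenvalue.
\<close>

lemma sum_cartan_int_proportional:
  fixes R :: "'a::euclidean_space set"
  assumes R: "finite_root_system R" and b: "\<beta> \<in> R"
  shows "2 *\<^sub>R (\<Sum>\<alpha>\<in>R. cartan_int (\<bullet>) \<beta> \<alpha> *\<^sub>R \<alpha>) =
    (\<Sum>\<alpha>\<in>R. cartan_int (\<bullet>) \<beta> \<alpha> * cartan_int (\<bullet>) \<alpha> \<beta>) *\<^sub>R \<beta>"
proof -
  let ?s = "root_reflection (\<bullet>) \<beta>"
  have b0: "\<beta> \<noteq> 0" using R b by (auto simp: finite_root_system_def)
  have invol: "?s (?s x) = x" for x
    using b0 by (simp add: root_reflection_def cartan_int_def inner_diff_left diff_divide_distrib algebra_simps)
  have inn: "\<beta> \<bullet> ?s x = - (\<beta> \<bullet> x)" "?s x \<bullet> ?s x = x \<bullet> x" for x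
    using b0 by (simp_all add: root_reflection_def cartan_int_def inner_diff_left inner_diff_right
        inner_commute divide_simps)
  have bij: "bij_betw ?s R R"
    by (rule bij_betw_byWitness[where f' = ?s])
      (use invol root_reflection_in_roots[OF R b] in auto)
  have "(\<Sum>\<alpha>\<in>R. cartan_int (\<bullet>) \<beta> \<alpha> *\<^sub>R \<alpha>) = (\<Sum>\<alpha>\<in>R. cartan_int (\<bullet>) \<beta> (?s \<alpha>) *\<^sub>R ?s \<alpha>)"
    by (rule sum.reindex_bij_betw[OF bij, symmetric])
  also have "\<dots> = (\<Sum>\<alpha>\<in>R. (cartan_int (\<bullet>) \<beta> \<alpha> * cartan_int (\<bullet>) \<alpha> \<beta>) *\<^sub>R \<beta>
      - cartan_int (\<bullet>) \<beta> \<alpha> *\<^sub>R \<alpha>)"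
  proof (rule sum.cong)
    fix \<alpha>
    have "cartan_int (\<bullet>) \<beta> (?s \<alpha>) = - cartan_int (\<bullet>) \<beta> \<alpha>"
      using inn[of \<alpha>] by (simp add: cartan_int_def)
    then show "cartan_int (\<bullet>) \<beta> (?s \<alpha>) *\<^sub>R ?s \<alpha> =
      (cartan_int (\<bullet>) \<beta> \<alpha> * cartan_int (\<bullet>) \<alpha> \<beta>) *\<^sub>R \<beta> - cartan_int (\<bullet>) \<beta> \<alpha> *\<^sub>R \<alpha>"
      by (simp add: root_reflection_def algebra_simps)
  qed simp
  also have "\<dots> = (\<Sum>\<alpha>\<in>R. cartan_int (\<bullet>) \<beta> \<alpha> * cartan_int (\<bullet>) \<alpha> \<beta>) *\<^sub>R \<beta>
      - (\<Sum>\<alpha>\<in>R. cartan_int (\<bullet>) \<beta> \<alpha> *\<^sub>R \<alpha>)"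
    by (simp add: sum_subtractf scaleR_left.sum)
  finally show ?thesis by (simp add: scaleR_2 algebra_simps)
qed

text \<open>
  The operator \<open>T x = (\<Sum>\<alpha>\<in>R. cartan_int (\<bullet>) x \<alpha> *\<^sub>R \<alpha>)\<close> has every root as an eigenvector, with a positive
  eigenvalue. As \<open>T\<close> is self-adjoint, non-orthogonal roots have the same eigenvalue, so by
  irreducibility there is only one, \<open>N / 2\<close>. The expression
  \<open>\<Sum>\<alpha>\<in>R. cartan_int (\<bullet>) x \<alpha> * p \<alpha>\<close> is defined and linear for all \<open>x\<close>; at a root \<open>x\<close> it is the value of the
  \<open>\<int>\<close>-linear extension of \<open>p\<close> at \<open>T x = (N / 2) x\<close>, that is \<open>(N / 2) p x\<close>. Dividing by the
  eigenvalue gives the extension.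
\<close>

lemma Z_linear_on_extends_linear:
  fixes R :: "'a::euclidean_space set"
  assumes R: "finite_root_system R" and irr: "irreducible_roots (\<bullet>) R" and p: "Z_linear_on R p"
  shows "\<exists>f. linear f \<and> (\<forall>\<alpha>\<in>R. f \<alpha> = real_of_int (p \<alpha>))"
proof -
  let ?N = "\<lambda>\<beta>. \<Sum>\<alpha>\<in>R. cartan_int (\<bullet>) \<beta> \<alpha> * cartan_int (\<bullet>) \<alpha> \<beta>"
  let ?T = "\<lambda>x. \<Sum>\<alpha>\<in>R. cartan_int (\<bullet>) x \<alpha> *\<^sub>R \<alpha>"
  have fin: "finite R" and nz: "\<And>\<alpha>. \<alpha> \<in> R \<Longrightarrow> \<alpha> \<noteq> 0"
    using R by (auto simp: finite_root_system_def)
  obtain h where h: "\<And>c::'a \<Rightarrow> int. h (\<Sum>\<alpha>\<in>R. of_int (c \<alpha>) *\<^sub>R \<alpha>) = (\<Sum>\<alpha>\<in>R. c \<alpha> * p \<alpha>)"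
    using Z_linear_on_sum[OF fin p] by blast
  have Npos: "?N \<beta> > 0" if "\<beta> \<in> R" for \<beta>
  proof (rule sum_pos2[OF fin that])
    show "0 < cartan_int (\<bullet>) \<beta> \<beta> * cartan_int (\<bullet>) \<beta> \<beta>"
      using nz[OF that] by (simp add: cartan_int_def)
  qed (simp add: cartan_int_def inner_commute)
  have self_adjoint: "?T x \<bullet> y = x \<bullet> ?T y" for x y
    by (simp add: inner_sum_left inner_sum_right cartan_int_def mult_ac inner_commute)
  have step: "?N \<alpha> = ?N \<beta>" if "\<alpha> \<in> R" "\<beta> \<in> R" "\<alpha> \<bullet> \<beta> \<noteq> 0" for \<alpha> \<beta>
  proof -
    have "?N \<alpha> * (\<alpha> \<bullet> \<beta>) = (2 *\<^sub>R ?T \<alpha>) \<bullet> \<beta>"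
      using sum_cartan_int_proportional[OF R that(1)] by simp
    also have "\<dots> = \<alpha> \<bullet> (2 *\<^sub>R ?T \<beta>)"
      using self_adjoint by simp
    also have "\<dots> = ?N \<beta> * (\<alpha> \<bullet> \<beta>)"
      using sum_cartan_int_proportional[OF R that(2)] by simp
    finally show ?thesis using that(3) by simp
  qed
  obtain \<alpha>\<^sub>0 where a0: "\<alpha>\<^sub>0 \<in> R" using irr by (auto simp: irreducible_roots_def)
  have N: "?N \<beta> = ?N \<alpha>\<^sub>0" if "\<beta> \<in> R" for \<beta>
    by (rule irreducible_roots_constant[OF irr step that a0])
  define f where "f x = (2 / ?N \<alpha>\<^sub>0) * (\<Sum>\<alpha>\<in>R. cartan_int (\<bullet>) x \<alpha> * of_int (p \<alpha>))" for x
  have "linear f"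
    unfolding f_def cartan_int_def
    by (intro linearI) (simp_all add: inner_add_left sum.distrib sum_distrib_left field_simps add_divide_distrib)
  moreover have "f \<beta> = of_int (p \<beta>)" if b: "\<beta> \<in> R" for \<beta>
  proof -
    have k: "of_int \<lfloor>cartan_int (\<bullet>) \<beta> \<alpha>\<rfloor> = cartan_int (\<bullet>) \<beta> \<alpha>" if "\<alpha> \<in> R" for \<alpha>
      using cartan_int_Ints[OF R that b] by (auto elim: Ints_cases)
    have "?N \<beta> \<in> \<int>"
      by (intro Ints_sum Ints_mult cartan_int_Ints[OF R]) (use b in auto)
    then obtain m where m: "?N \<beta> = of_int m" by (auto elim: Ints_cases)
    \<comment> \<open>The factor 2 turns the eigenvalue into \<open>N\<close>, which is a sum of products of integers.\<close>
    have "(\<Sum>\<alpha>\<in>R. of_int (2 * \<lfloor>cartan_int (\<bullet>) \<beta> \<alpha>\<rfloor>) *\<^sub>R \<alpha>) = 2 *\<^sub>R ?T \<beta>"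
      unfolding scaleR_sum_right by (rule sum.cong) (simp_all add: k)
    also have "\<dots> = of_int m *\<^sub>R \<beta>"
      using sum_cartan_int_proportional[OF R b] m by simp
    also have "\<dots> = (\<Sum>\<alpha>\<in>R. of_int (if \<alpha> = \<beta> then m else 0) *\<^sub>R \<alpha>)"
      using fin b by (simp add: if_distrib[of of_int] if_distrib[of "\<lambda>t. t *\<^sub>R _"] cong: if_cong)
    finally have "h (\<Sum>\<alpha>\<in>R. of_int (2 * \<lfloor>cartan_int (\<bullet>) \<beta> \<alpha>\<rfloor>) *\<^sub>R \<alpha>)
        = h (\<Sum>\<alpha>\<in>R. of_int (if \<alpha> = \<beta> then m else 0) *\<^sub>R \<alpha>)"
      by (rule arg_cong)
    then have "(\<Sum>\<alpha>\<in>R. (2 * \<lfloor>cartan_int (\<bullet>) \<beta> \<alpha>\<rfloor>) * p \<alpha>) = (\<Sum>\<alpha>\<in>R. (if \<alpha> = \<beta> then m else 0) * p \<alpha>)"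
      unfolding h .
    also have "\<dots> = m * p \<beta>"
      using fin b by (simp add: if_distrib[of "\<lambda>t. t * _"] cong: if_cong)
    finally have "real_of_int (\<Sum>\<alpha>\<in>R. (2 * \<lfloor>cartan_int (\<bullet>) \<beta> \<alpha>\<rfloor>) * p \<alpha>) = of_int (m * p \<beta>)"
      by simp
    then have "2 * (\<Sum>\<alpha>\<in>R. cartan_int (\<bullet>) \<beta> \<alpha> * of_int (p \<alpha>)) = ?N \<beta> * of_int (p \<beta>)"
      unfolding m by (simp add: k sum_distrib_left mult_ac)
    then show ?thesis
      unfolding f_def N[OF b, symmetric] using Npos[OF b] by (simp add: field_simps)
  qed
  ultimately show ?thesis by blast
qed

section \<open>Closed subroot systems of the affine root system\<close>

lemma cartan_int_affine_form [simp]: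
  "cartan_int affine_form x y = cartan_int (\<bullet>) (fst x) (fst y)"
  by (simp add: cartan_int_def affine_form_def)

lemma root_reflection_affine_form:
  "root_reflection affine_form (\<alpha>, r) (\<beta>, s) =
    (root_reflection (\<bullet>) \<alpha> \<beta>, s - cartan_int (\<bullet>) \<beta> \<alpha> * r)"
  by (simp add: root_reflection_def)

text \<open>
  The offset \<open>p\<close> is the restriction of a linear function, so reflections and sums of elements
  of the cosets \<open>p \<alpha> + n\<int>\<close> stay in these cosets. For \<open>n = 0\<close> a single affine root lies over each
  root.
\<close>

lemma closed_subroot_system_shifted_lift:
  fixes f :: "'a::euclidean_space \<Rightarrow> real"
  assumes R: "finite_root_system R" and ne: "R \<noteq> {}"
    and f: "linear f" and fp: "\<And>\<alpha>. \<alpha> \<in> R \<Longrightarrow> f \<alpha> = real_of_int (p \<alpha>)"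
  shows "closed_subroot_system affine_form (affine_lift R) (shifted_lift R p n)"
  unfolding closed_subroot_system_def subroot_system_def
proof (intro conjI ballI impI)
  show "shifted_lift R p n \<noteq> {}"
    using ne by (auto simp: shifted_lift_def)
  show "shifted_lift R p n \<subseteq> affine_lift R"
    unfolding shifted_lift_def affine_lift_def by blast
next
  fix x y assume "x \<in> shifted_lift R p n" "y \<in> shifted_lift R p n"
  then obtain \<alpha> \<beta> r s where x: "x = (\<alpha>, of_int (p \<alpha> + r * int n))" "\<alpha> \<in> R"
    and y: "y = (\<beta>, of_int (p \<beta> + s * int n))" "\<beta> \<in> R"
    by (auto simp: shifted_lift_def)
  obtain k where k: "cartan_int (\<bullet>) \<beta> \<alpha> = of_int k"
    using cartan_int_Ints[OF R x(2) y(2)] by (auto elim: Ints_cases)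
  let ?\<gamma> = "root_reflection (\<bullet>) \<alpha> \<beta>"
  have g: "?\<gamma> \<in> R" by (rule root_reflection_in_roots[OF R x(2) y(2)])
  have "of_int (p ?\<gamma>) = f \<beta> - of_int k * f \<alpha>"
    using fp[OF g] f by (simp add: root_reflection_def k linear_diff linear_cmul)
  then have "root_reflection affine_form x y = (?\<gamma>, of_int (p ?\<gamma> + (s - k * r) * int n))"
    using fp x y by (simp add: root_reflection_affine_form k algebra_simps)
  with g show "root_reflection affine_form x y \<in> shifted_lift R p n"
    unfolding shifted_lift_def by blast
  assume "x + y \<in> affine_lift R"
  then have ab: "\<alpha> + \<beta> \<in> R"
    by (auto simp: affine_lift_def x y)
  have "of_int (p (\<alpha> + \<beta>)) = real_of_int (p \<alpha>) + of_int (p \<beta>)"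
    using fp[OF ab] fp x(2) y(2) f by (simp add: linear_add)
  then have "x + y = (\<alpha> + \<beta>, of_int (p (\<alpha> + \<beta>) + (r + s) * int n))"
    by (simp add: x y algebra_simps)
  with ab show "x + y \<in> shifted_lift R p n"
    unfolding shifted_lift_def by blast
qed

lemma shifted_lift_1: "shifted_lift R p 1 = affine_lift R"
proof -
  have "(\<alpha>, real_of_int r) = (\<alpha>, of_int (p \<alpha> + (r - p \<alpha>) * int 1))" for \<alpha> :: 'a and r
    by simp
  then show ?thesis
    unfolding shifted_lift_def affine_lift_def by blast
qed

lemma shifted_lift_mono:
  assumes "m dvd n"
  shows "shifted_lift R p n \<subseteq> shifted_lift R p m"
proof -
  obtain k where k: "n = m * k" using assms by blast
  have "(\<alpha>, real_of_int (p \<alpha> + r * int n)) = (\<alpha>, of_int (p \<alpha> + (r * int k) * int m))" for \<alpha> :: 'a and r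
    by (simp add: k)
  then show ?thesis unfolding shifted_lift_def by blast
qed

lemma shifted_lift_subset_iff:
  assumes "R \<noteq> {}"
  shows "shifted_lift R p n \<subseteq> shifted_lift R p m \<longleftrightarrow> m dvd n"
proof
  assume sub: "shifted_lift R p n \<subseteq> shifted_lift R p m"
  obtain \<alpha> where "\<alpha> \<in> R" using assms by blast
  then have "(\<alpha>, of_int (p \<alpha> + 1 * int n)) \<in> shifted_lift R p n"
    unfolding shifted_lift_def by blast
  with sub have "(\<alpha>, of_int (p \<alpha> + 1 * int n)) \<in> shifted_lift R p m" by blast
  then obtain r where "real_of_int (p \<alpha> + 1 * int n) = of_int (p \<alpha> + r * int m)"
    unfolding shifted_lift_def by blast
  then have "int n = r * int m"
    by linarith
  then show "m dvd n" by (metis dvd_triv_right int_dvd_int_iff)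
qed (rule shifted_lift_mono)

lemma shifted_lift_proper:
  assumes "R \<noteq> {}" "n \<noteq> 1"
  shows "shifted_lift R p n \<subset> affine_lift R"
  using shifted_lift_subset_iff[OF assms(1), of p 1 n, unfolded shifted_lift_1]
    shifted_lift_mono[OF one_dvd, of R p n, unfolded shifted_lift_1] assms(2)
  by auto

text \<open>
  Composing the reflections \<open>s \<mapsto> 2r - s\<close> for \<open>r = 0\<close> and for the least positive element \<open>r = m\<close>
  gives the translation by \<open>2m\<close>. It remains to know \<open>S\<close> in \<open>{0..<2m}\<close>: by minimality no element lies
  strictly between 0 and \<open>m\<close>, hence by reflection none between \<open>m\<close> and \<open>2m\<close>.
\<close>

lemma int_set_closed_under_point_reflection:
  fixes S :: "int set"
  assumes 0: "0 \<in> S" and refl: "\<And>r s. r \<in> S \<Longrightarrow> s \<in> S \<Longrightarrow> 2 * r - s \<in> S"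
  shows "\<exists>m::nat. S = range (\<lambda>k. k * int m)"
proof (cases "S = {0}")
  case True
  then show ?thesis by (intro exI[of _ 0]) auto
next
  case False
  have neg: "- s \<in> S" if "s \<in> S" for s
    using refl[OF 0 that] by simp
  then have "\<exists>n::nat. n > 0 \<and> int n \<in> S"
    using 0 False by (metis abs_of_nonneg abs_if empty_iff insertI1 int_nat_eq of_nat_0_less_iff
        subset_singletonD subsetI zero_less_abs_iff abs_ge_zero insert_iff)
  then obtain m where m: "m > 0" "int m \<in> S" and least: "\<And>k. k < m \<Longrightarrow> k > 0 \<Longrightarrow> int k \<notin> S"
    using exists_least_iff[of "\<lambda>n. n > 0 \<and> int n \<in> S"] by blast
  have shift: "s + 2 * int m \<in> S" "s - 2 * int m \<in> S" if "s \<in> S" for s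
    using refl[OF m(2) neg[OF that]] refl[OF neg[OF m(2)] neg[OF that]] by (simp_all add: algebra_simps)
  have shifts: "s + q * (2 * int m) \<in> S" if "s \<in> S" for s q
  proof (induction q rule: int_induct[where k = 0])
    case base then show ?case using that by simp
  next
    case (step1 i) then show ?case using shift(1)[OF step1(2)] by (simp add: algebra_simps)
  next
    case (step2 i) then show ?case using shift(2)[OF step2(2)] by (simp add: algebra_simps)
  qed
  have "S = range (\<lambda>k. k * int m)"
  proof (intro equalityI subsetI)
    fix s assume s: "s \<in> S"
    define t where "t = s mod (2 * int m)"
    have t_eq: "t = s + (- (s div (2 * int m))) * (2 * int m)"
      by (simp add: t_def minus_div_mult_eq_mod[symmetric])
    have t: "t \<in> S" unfolding t_eq by (rule shifts[OF s])
    have range: "0 \<le> t" "t < 2 * int m" using m by (simp_all add: t_def)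
    have "t = 0 \<or> t = int m"
    proof (rule ccontr)
      assume c: "\<not> ?thesis"
      have "\<not> t < int m"
        using least[of "nat t"] t range c by (auto simp: nat_less_iff)
      moreover have "2 * int m - t \<in> S"
        using shift(1)[OF neg[OF t]] by simp
      ultimately show False
        using least[of "nat (2 * int m - t)"] range c by (auto simp: nat_less_iff)
    qed
    moreover have "s = t + (2 * (s div (2 * int m))) * int m"
      using t_eq by simp
    ultimately have "\<exists>k. s = k * int m"
      by (metis add.commute add_0 distrib_right mult_1)
    then show "s \<in> range (\<lambda>k. k * int m)" by auto
  next
    fix s assume "s \<in> range (\<lambda>k. k * int m)"
    then obtain k where k: "s = k * int m" by auto
    show "s \<in> S"
    proof (cases "even k")
      case True
      then obtain q where "k = 2 * q" by blast
      with shifts[OF 0, of q] k show ?thesis by (simp add: algebra_simps)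
    next
      case False
      then obtain q where "k = 2 * q + 1" by (elim oddE)
      with shifts[OF m(2), of q] k show ?thesis by (simp add: algebra_simps)
    qed
  qed
  then show ?thesis by blast
qed

context
  fixes R :: "'a::euclidean_space set" and \<Delta> :: "('a \<times> real) set"
  assumes R: "finite_root_system R"
    and closed: "closed_subroot_system affine_form (affine_lift R) \<Delta>"
begin

lemma affine_root_fst: "(\<alpha>, r) \<in> \<Delta> \<Longrightarrow> \<alpha> \<in> R"
  using closed by (auto simp: closed_subroot_system_def subroot_system_def affine_lift_def)

lemma affine_root_snd: "(\<alpha>, r) \<in> \<Delta> \<Longrightarrow> r \<in> \<int>"
  using closed by (auto simp: closed_subroot_system_def subroot_system_def affine_lift_def)

lemma affine_reflection:
  assumes "(\<alpha>, r) \<in> \<Delta>" "(\<beta>, s) \<in> \<Delta>"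
  shows "(root_reflection (\<bullet>) \<alpha> \<beta>, s - cartan_int (\<bullet>) \<beta> \<alpha> * r) \<in> \<Delta>"
  using closed assms unfolding closed_subroot_system_def subroot_system_def root_reflection_affine_form[symmetric]
  by blast

lemma affine_reflection_same_gradient:
  assumes "(\<alpha>, r) \<in> \<Delta>" "(\<alpha>, s) \<in> \<Delta>"
  shows "(- \<alpha>, s - 2 * r) \<in> \<Delta>"
proof -
  have "\<alpha> \<noteq> 0" using affine_root_fst[OF assms(1)] R by (auto simp: finite_root_system_def)
  then show ?thesis
    using affine_reflection[OF assms] by (simp add: root_reflection_def cartan_int_def scaleR_2)
qed

lemma affine_neg: "(\<alpha>, r) \<in> \<Delta> \<Longrightarrow> (- \<alpha>, - r) \<in> \<Delta>"
  using affine_reflection_same_gradient[of \<alpha> r r] by simp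

lemma affine_add:
  assumes "(\<alpha>, r) \<in> \<Delta>" "(\<beta>, s) \<in> \<Delta>" "\<alpha> + \<beta> \<in> R"
  shows "(\<alpha> + \<beta>, r + s) \<in> \<Delta>"
proof -
  obtain i j where "r = of_int i" "s = of_int j"
    using assms affine_root_snd by (metis Ints_cases)
  then have "(\<alpha>, r) + (\<beta>, s) = (\<alpha> + \<beta>, of_int (i + j))" by simp
  then have "(\<alpha>, r) + (\<beta>, s) \<in> affine_lift R"
    using assms(3) unfolding affine_lift_def by blast
  then have "(\<alpha>, r) + (\<beta>, s) \<in> \<Delta>"
    using closed assms unfolding closed_subroot_system_def by blast
  then show ?thesis by simp
qed

text \<open>
  The simple roots are the indecomposable elements \<open>S\<close> of the half \<open>P\<close> of the roots on which a
  regular vector \<open>v\<close> is positive. A section chosen over \<open>S\<close> and extended linearly spreads to \<open>P\<close> by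
  closedness, since splitting a positive root into positive summands lowers the inner product
  with \<open>v\<close> and therefore ends in simple roots.
\<close>

lemma ex_linear_section:
  assumes full: "gradient R \<Delta> = R"
  shows "\<exists>f. linear f \<and> (\<forall>\<alpha>\<in>R. (\<alpha>, f \<alpha>) \<in> \<Delta>)"
proof -
  have fin: "finite R" and R0: "0 \<notin> R"
    using R by (auto simp: finite_root_system_def)
  obtain v where v: "\<And>\<alpha>. \<alpha> \<in> R \<Longrightarrow> v \<bullet> \<alpha> \<noteq> 0"
    using ex_regular_vector[OF fin R0] by blast
  define P where "P = {\<alpha> \<in> R. v \<bullet> \<alpha> > 0}"
  define S where "S = {\<alpha> \<in> P. \<not> (\<exists>\<beta>\<in>P. \<exists>\<gamma>\<in>P. \<alpha> = \<beta> + \<gamma>)}"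
  have finP: "finite P" using fin by (simp add: P_def)
  have PR: "P \<subseteq> R" and SP: "S \<subseteq> P" by (auto simp: P_def S_def)
  have P_cases: "\<alpha> \<in> P \<or> - \<alpha> \<in> P" if "\<alpha> \<in> R" for \<alpha>
    using v[OF that] uminus_root[OF R that] that by (auto simp: P_def)
  have "independent S"
  proof (rule independent_if_obtuse_in_half_space)
    show "finite S" using finP SP by (rule rev_finite_subset)
    show "v \<bullet> s > 0" if "s \<in> S" for s using that by (auto simp: S_def P_def)
    show "s \<bullet> t \<le> 0" if s: "s \<in> S" and t: "t \<in> S" and "s \<noteq> t" for s t
    proof (rule ccontr)
      assume "\<not> s \<bullet> t \<le> 0"
      then have "s - t \<in> R"
        using diff_root_of_acute[OF R, of s t] s t SP PR \<open>s \<noteq> t\<close> by auto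
      then have "s - t \<in> P \<or> t - s \<in> P" using P_cases by fastforce
      moreover have "s = t + (s - t)" "t = s + (t - s)" by simp_all
      ultimately show False using s t unfolding S_def by blast
    qed
  qed
  moreover have "\<forall>\<alpha>\<in>S. \<exists>r. (\<alpha>, r) \<in> \<Delta>"
    using full SP PR unfolding gradient_def by blast
  then obtain q where q: "\<And>\<alpha>. \<alpha> \<in> S \<Longrightarrow> (\<alpha>, q \<alpha>) \<in> \<Delta>" by metis
  ultimately obtain f where f: "linear f" and fq: "\<And>\<alpha>. \<alpha> \<in> S \<Longrightarrow> f \<alpha> = q \<alpha>"
    using linear_independent_extend[of S q] by blast
  have pos: "(\<alpha>, f \<alpha>) \<in> \<Delta>" if "\<alpha> \<in> P" for \<alpha>
    using that
  proof (induction "card {\<beta> \<in> P. v \<bullet> \<beta> < v \<bullet> \<alpha>}" arbitrary: \<alpha> rule: less_induct)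
    case less
    show ?case
    proof (cases "\<alpha> \<in> S")
      case True
      then show ?thesis using q fq by simp
    next
      case False
      then obtain \<beta> \<gamma> where bc: "\<beta> \<in> P" "\<gamma> \<in> P" "\<alpha> = \<beta> + \<gamma>"
        using less.prems unfolding S_def by blast
      have "card {\<eta> \<in> P. v \<bullet> \<eta> < v \<bullet> \<theta>} < card {\<eta> \<in> P. v \<bullet> \<eta> < v \<bullet> \<alpha>}"
        if "\<theta> \<in> P" "v \<bullet> \<theta> < v \<bullet> \<alpha>" for \<theta>
        by (rule psubset_card_mono) (use finP that in auto)
      moreover have "v \<bullet> \<beta> < v \<bullet> \<alpha>" "v \<bullet> \<gamma> < v \<bullet> \<alpha>"
        using bc by (auto simp: P_def inner_add_right)
      ultimately have "(\<beta>, f \<beta>) \<in> \<Delta>" "(\<gamma>, f \<gamma>) \<in> \<Delta>"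
        using less.hyps bc by blast+
      then show ?thesis
        using affine_add[of \<beta> "f \<beta>" \<gamma> "f \<gamma>"] less.prems PR bc f by (auto simp: linear_add)
    qed
  qed
  have "(\<alpha>, f \<alpha>) \<in> \<Delta>" if "\<alpha> \<in> R" for \<alpha>
    using P_cases[OF that] pos[of \<alpha>] affine_neg[OF pos[of "- \<alpha>"]] f by (auto simp: linear_neg)
  with f show ?thesis by blast
qed

text \<open>
  Relative to the section \<open>f\<close>, the integers \<open>Z \<alpha>\<close> over a root \<open>\<alpha>\<close> form a subgroup, and the
  subgroups over non-orthogonal roots agree: for an acute angle because \<open>\<gamma> = (\<gamma> - \<beta>) + \<beta>\<close> is a sum of
  roots, and for an obtuse one after replacing \<open>\<beta>\<close> by \<open>- \<beta>\<close>.
\<close>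

lemma eq_shifted_lift_of_section:
  assumes irr: "irreducible_roots (\<bullet>) R"
    and f: "linear f" and sec: "\<And>\<alpha>. \<alpha> \<in> R \<Longrightarrow> (\<alpha>, f \<alpha>) \<in> \<Delta>"
    and fp: "\<And>\<alpha>. \<alpha> \<in> R \<Longrightarrow> f \<alpha> = real_of_int (p \<alpha>)"
  shows "\<exists>m. \<Delta> = shifted_lift R p m"
proof -
  define Z where "Z \<alpha> = {r::int. (\<alpha>, f \<alpha> + of_int r) \<in> \<Delta>}" for \<alpha>
  have Z0: "0 \<in> Z \<alpha>" if "\<alpha> \<in> R" for \<alpha>
    using sec[OF that] by (simp add: Z_def)
  have Zneg: "- r \<in> Z (- \<alpha>)" if "r \<in> Z \<alpha>" for r \<alpha>
    using affine_neg[of \<alpha> "f \<alpha> + of_int r"] that f by (simp add: Z_def linear_neg algebra_simps)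
  have Zflip: "2 * r - s \<in> Z \<alpha>" if "r \<in> Z \<alpha>" "s \<in> Z \<alpha>" for r s \<alpha>
    using affine_neg[OF affine_reflection_same_gradient[of \<alpha> "f \<alpha> + of_int r" "f \<alpha> + of_int s"]] that
    by (simp add: Z_def algebra_simps)
  have Zminus: "Z (- \<alpha>) = Z \<alpha>" if a: "\<alpha> \<in> R" for \<alpha>
  proof -
    have "r \<in> Z (- \<beta>)" if "r \<in> Z \<beta>" "\<beta> \<in> R" for r \<beta>
      using Zneg[OF Zflip[OF Z0[OF that(2)] that(1)]] by simp
    from this[of _ \<alpha>] this[of _ "- \<alpha>"] show ?thesis
      using a uminus_root[OF R a] by auto
  qed
  have acute_sub: "Z \<beta> \<subseteq> Z \<gamma>" if b: "\<beta> \<in> R" and c: "\<gamma> \<in> R" and pos: "\<gamma> \<bullet> \<beta> > 0" for \<beta> \<gamma>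
  proof (cases "\<gamma> = \<beta>")
    case False
    have d: "\<gamma> - \<beta> \<in> R" by (rule diff_root_of_acute[OF R c b pos False])
    show ?thesis
    proof
      fix r assume "r \<in> Z \<beta>"
      then have "(\<gamma> - \<beta> + \<beta>, f (\<gamma> - \<beta>) + (f \<beta> + of_int r)) \<in> \<Delta>"
        using c by (intro affine_add sec[OF d]) (auto simp: Z_def)
      then show "r \<in> Z \<gamma>" using f by (simp add: Z_def linear_diff)
    qed
  qed simp
  have acute: "Z \<gamma> = Z \<beta>" if "\<beta> \<in> R" "\<gamma> \<in> R" "\<gamma> \<bullet> \<beta> > 0" for \<beta> \<gamma>
    using acute_sub[OF that] acute_sub[OF that(2,1)] that(3) by (auto simp: inner_commute)
  have step: "Z \<gamma> = Z \<beta>" if "\<gamma> \<in> R" "\<beta> \<in> R" "\<gamma> \<bullet> \<beta> \<noteq> 0" for \<beta> \<gamma>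
  proof (cases "\<gamma> \<bullet> \<beta> > 0")
    case True
    then show ?thesis by (rule acute[OF that(2,1)])
  next
    case False
    then have "\<gamma> \<bullet> - \<beta> > 0" using that(3) by simp
    then show ?thesis
      using acute[OF uminus_root[OF R that(2)] that(1)] Zminus[OF that(2)] by simp
  qed
  obtain \<alpha>\<^sub>0 where a0: "\<alpha>\<^sub>0 \<in> R" using irr by (auto simp: irreducible_roots_def)
  obtain m :: nat where m: "Z \<alpha>\<^sub>0 = range (\<lambda>k. k * int m)"
    using int_set_closed_under_point_reflection[OF Z0[OF a0] Zflip] by blast
  have Zm: "Z \<alpha> = range (\<lambda>k. k * int m)" if "\<alpha> \<in> R" for \<alpha>
    using irreducible_roots_constant[where g = Z, OF irr step that a0] m by simp
  have "\<Delta> = shifted_lift R p m"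
  proof (intro equalityI subrelI)
    fix \<alpha> t assume at: "(\<alpha>, t) \<in> \<Delta>"
    then have a: "\<alpha> \<in> R" by (rule affine_root_fst)
    obtain i where i: "t = of_int i" using affine_root_snd[OF at] by (elim Ints_cases)
    have "i - p \<alpha> \<in> Z \<alpha>" using at i fp[OF a] by (simp add: Z_def)
    then obtain k where "i - p \<alpha> = k * int m" using Zm[OF a] by blast
    then have "i = p \<alpha> + k * int m" by simp
    then show "(\<alpha>, t) \<in> shifted_lift R p m"
      using a i unfolding shifted_lift_def by blast
  next
    fix \<alpha> t assume "(\<alpha>, t) \<in> shifted_lift R p m"
    then obtain r where a: "\<alpha> \<in> R" and t: "t = of_int (p \<alpha> + r * int m)"
      by (auto simp: shifted_lift_def)
    have "r * int m \<in> Z \<alpha>" using Zm[OF a] by blast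
    then show "(\<alpha>, t) \<in> \<Delta>" using fp[OF a] t by (simp add: Z_def)
  qed
  then show ?thesis by blast
qed

lemma ex_integral_section:
  assumes irr: "irreducible_roots (\<bullet>) R" and full: "gradient R \<Delta> = R"
  shows "\<exists>f p m. linear f \<and> (\<forall>\<alpha>\<in>R. f \<alpha> = real_of_int (p \<alpha>)) \<and> \<Delta> = shifted_lift R p m"
proof -
  obtain f where f: "linear f" and sec: "\<And>\<alpha>. \<alpha> \<in> R \<Longrightarrow> (\<alpha>, f \<alpha>) \<in> \<Delta>"
    using ex_linear_section[OF full] by blast
  have fp: "f \<alpha> = of_int \<lfloor>f \<alpha>\<rfloor>" if "\<alpha> \<in> R" for \<alpha>
    using affine_root_snd[OF sec[OF that]] by (auto elim: Ints_cases)
  obtain m where "\<Delta> = shifted_lift R (\<lambda>\<alpha>. \<lfloor>f \<alpha>\<rfloor>) m"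
    using eq_shifted_lift_of_section[OF irr f sec fp] by blast
  with f fp show ?thesis
    by (intro exI[of _ f] exI[of _ "\<lambda>\<alpha>. \<lfloor>f \<alpha>\<rfloor>"] exI[of _ m] conjI ballI)
qed

lemma closed_subroot_system_gradient:
  "closed_subroot_system (\<bullet>) R (gradient R \<Delta>)"
  unfolding closed_subroot_system_def subroot_system_def
proof (intro conjI ballI impI)
  have grad: "\<alpha> \<in> gradient R \<Delta> \<longleftrightarrow> (\<exists>r. (\<alpha>, r) \<in> \<Delta>)" for \<alpha>
    unfolding gradient_def using affine_root_fst affine_root_snd by simp (metis Ints_cases)
  obtain x where "x \<in> \<Delta>"
    using closed unfolding closed_subroot_system_def subroot_system_def by blast
  then show "gradient R \<Delta> \<noteq> {}"
    using grad[of "fst x"] by (cases x) auto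
  show "gradient R \<Delta> \<subseteq> R" by (auto simp: gradient_def)
  fix \<alpha> \<beta> assume "\<alpha> \<in> gradient R \<Delta>" "\<beta> \<in> gradient R \<Delta>"
  then obtain r s where "(\<alpha>, r) \<in> \<Delta>" "(\<beta>, s) \<in> \<Delta>" by (auto simp: grad)
  then show "root_reflection (\<bullet>) \<alpha> \<beta> \<in> gradient R \<Delta>"
    and "\<alpha> + \<beta> \<in> R \<Longrightarrow> \<alpha> + \<beta> \<in> gradient R \<Delta>"
    using affine_reflection affine_add unfolding grad by blast+
qed

lemma subset_affine_lift_gradient: "\<Delta> \<subseteq> affine_lift (gradient R \<Delta>)"
proof (intro subrelI)
  fix \<alpha> t assume at: "(\<alpha>, t) \<in> \<Delta>"
  obtain i where "t = of_int i" using affine_root_snd[OF at] by (elim Ints_cases)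
  with at affine_root_fst[OF at] show "(\<alpha>, t) \<in> affine_lift (gradient R \<Delta>)"
    unfolding gradient_def affine_lift_def by blast
qed

end

text \<open>
  A linear function with integer values on the roots is integral on the whole root lattice, so
  rounding down is additive there.
\<close>

lemma Z_linear_on_of_linear:
  assumes f: "linear f" and fp: "\<And>\<alpha>. \<alpha> \<in> R \<Longrightarrow> f \<alpha> = real_of_int (p \<alpha>)"
  shows "Z_linear_on R p"
proof -
  have Int: "f x \<in> \<int>" if "x \<in> root_lattice R" for x
    using that f fp unfolding root_lattice_def
    by (auto simp: linear_sum linear_cmul intro!: Ints_sum Ints_mult)
  have "\<lfloor>f (x + y)\<rfloor> = \<lfloor>f x\<rfloor> + \<lfloor>f y\<rfloor>" if "x \<in> root_lattice R" "y \<in> root_lattice R" for x y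
    using Int[OF that(1)] f by (auto elim!: Ints_cases simp: linear_add)
  then show ?thesis
    unfolding Z_linear_on_def using fp by (intro exI[of _ "\<lambda>x. \<lfloor>f x\<rfloor>"]) simp
qed

lemma reflection_compatible_of_linear:
  assumes R: "finite_root_system R"
    and f: "linear f" and fp: "\<And>\<alpha>. \<alpha> \<in> R \<Longrightarrow> f \<alpha> = real_of_int (p \<alpha>)"
  shows "reflection_compatible R p"
  unfolding reflection_compatible_def
proof (intro ballI)
  fix \<alpha> \<beta> assume ab: "\<alpha> \<in> R" "\<beta> \<in> R"
  show "real_of_int (p \<beta>) - cartan_int (\<bullet>) \<beta> \<alpha> * real_of_int (p \<alpha>) =
      real_of_int (p (root_reflection (\<bullet>) \<alpha> \<beta>))"
    unfolding fp[OF ab(1), symmetric] fp[OF ab(2), symmetric]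
      fp[OF root_reflection_in_roots[OF R ab], symmetric]
    using f by (simp add: root_reflection_def linear_diff linear_cmul)
qed

section \<open>Maximal closed subroot systems\<close>

text \<open>
  A closed system \<open>\<Delta>\<close> above \<open>shifted_lift R p n\<close> contains the same section \<open>p\<close>, so it is
  \<open>shifted_lift R p m\<close> with \<open>m\<close> a divisor of \<open>n\<close>.
\<close>

lemma maximal_shifted_lift:
  assumes R: "finite_root_system R" and irr: "irreducible_roots (\<bullet>) R"
    and f: "linear f" and fp: "\<And>\<alpha>. \<alpha> \<in> R \<Longrightarrow> f \<alpha> = real_of_int (p \<alpha>)" and n: "prime n"
  shows "maximal_closed_subroot_system affine_form (affine_lift R) (shifted_lift R p n)"
  unfolding maximal_closed_subroot_system_def
proof (intro conjI allI impI)
  have ne: "R \<noteq> {}" using irr by (auto simp: irreducible_roots_def)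
  show "closed_subroot_system affine_form (affine_lift R) (shifted_lift R p n)"
    by (rule closed_subroot_system_shifted_lift[OF R ne f fp])
  have "n \<noteq> 1" using n by auto
  then show "shifted_lift R p n \<noteq> affine_lift R"
    using shifted_lift_proper[OF ne] by blast
  fix \<Delta> assume \<Delta>: "closed_subroot_system affine_form (affine_lift R) \<Delta>"
    and sub: "shifted_lift R p n \<subseteq> \<Delta>" and proper: "\<Delta> \<subset> affine_lift R"
  have "(\<alpha>, f \<alpha>) \<in> \<Delta>" if "\<alpha> \<in> R" for \<alpha>
  proof -
    have "(\<alpha>, of_int (p \<alpha> + 0 * int n)) \<in> shifted_lift R p n"
      using that unfolding shifted_lift_def by blast
    then show ?thesis using sub fp[OF that] by auto
  qed
  then obtain m where m: "\<Delta> = shifted_lift R p m"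
    using eq_shifted_lift_of_section[OF R \<Delta> irr f _ fp] by blast
  then have "m dvd n" using sub shifted_lift_subset_iff[OF ne] by blast
  moreover have "m \<noteq> 1" using m proper shifted_lift_1[of R p] by auto
  ultimately have "m = n" using n by (auto simp: prime_nat_iff)
  with m show "\<Delta> = shifted_lift R p n" by simp
qed

text \<open>
  Any prime divisor \<open>q\<close> of \<open>n\<close> gives a proper closed system above the given one, so \<open>q = n\<close>. This also
  excludes \<open>n = 0\<close>, which every prime divides.
\<close>

lemma prime_of_maximal_shifted_lift:
  assumes R: "finite_root_system R" and irr: "irreducible_roots (\<bullet>) R"
    and f: "linear f" and fp: "\<And>\<alpha>. \<alpha> \<in> R \<Longrightarrow> f \<alpha> = real_of_int (p \<alpha>)"
    and max: "maximal_closed_subroot_system affine_form (affine_lift R) (shifted_lift R p n)"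
  shows "prime n"
proof -
  have ne: "R \<noteq> {}" using irr by (auto simp: irreducible_roots_def)
  have "n \<noteq> 1"
    using max shifted_lift_1[of R p] by (auto simp: maximal_closed_subroot_system_def)
  then obtain q where q: "prime q" "q dvd n" using prime_factor_nat by blast
  have q1: "q \<noteq> 1" using q(1) by auto
  have "shifted_lift R p q = shifted_lift R p n"
    using max closed_subroot_system_shifted_lift[OF R ne f fp, of q] shifted_lift_mono[OF q(2), of R p]
      shifted_lift_proper[OF ne q1, of p]
    unfolding maximal_closed_subroot_system_def by blast
  then have "n dvd q"
    using shifted_lift_subset_iff[OF ne] by blast
  with q show ?thesis using dvd_antisym by blast
qed

lemma affine_lift_mono_iff: "affine_lift A \<subseteq> affine_lift B \<longleftrightarrow> A \<subseteq> B"
proof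
  assume sub: "affine_lift A \<subseteq> affine_lift B"
  show "A \<subseteq> B"
  proof
    fix \<alpha> assume "\<alpha> \<in> A"
    then have "(\<alpha>, of_int 0) \<in> affine_lift A" unfolding affine_lift_def by blast
    with sub show "\<alpha> \<in> B" by (auto simp: affine_lift_def)
  qed
qed (auto simp: affine_lift_def)

lemma affine_lift_eq_iff: "affine_lift A = affine_lift B \<longleftrightarrow> A = B"
  using affine_lift_mono_iff by (metis order_antisym order_refl)

lemma closed_subroot_system_affine_lift:
  assumes R: "finite_root_system R" and Q: "closed_subroot_system (\<bullet>) R Q"
  shows "closed_subroot_system affine_form (affine_lift R) (affine_lift Q)"
  unfolding closed_subroot_system_def subroot_system_def
proof (intro conjI ballI impI)
  have QR: "Q \<subseteq> R" and ne: "Q \<noteq> {}"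
    and refl: "\<And>\<alpha> \<beta>. \<alpha> \<in> Q \<Longrightarrow> \<beta> \<in> Q \<Longrightarrow> root_reflection (\<bullet>) \<alpha> \<beta> \<in> Q"
    and add: "\<And>\<alpha> \<beta>. \<alpha> \<in> Q \<Longrightarrow> \<beta> \<in> Q \<Longrightarrow> \<alpha> + \<beta> \<in> R \<Longrightarrow> \<alpha> + \<beta> \<in> Q"
    using Q unfolding closed_subroot_system_def subroot_system_def by blast+
  show "affine_lift Q \<noteq> {}" using ne by (auto simp: affine_lift_def)
  show "affine_lift Q \<subseteq> affine_lift R" using QR by (simp add: affine_lift_mono_iff)
  fix x y assume "x \<in> affine_lift Q" "y \<in> affine_lift Q"
  then obtain \<alpha> \<beta> r s where x: "x = (\<alpha>, of_int r)" "\<alpha> \<in> Q" and y: "y = (\<beta>, of_int s)" "\<beta> \<in> Q"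
    by (auto simp: affine_lift_def)
  obtain k where k: "cartan_int (\<bullet>) \<beta> \<alpha> = of_int k"
    using cartan_int_Ints[OF R] x y QR by (metis Ints_cases subsetD)
  have "root_reflection affine_form x y = (root_reflection (\<bullet>) \<alpha> \<beta>, of_int (s - k * r))"
    using x y by (simp add: root_reflection_affine_form k)
  with refl[OF x(2) y(2)] show "root_reflection affine_form x y \<in> affine_lift Q"
    unfolding affine_lift_def by blast
  assume "x + y \<in> affine_lift R"
  then have "\<alpha> + \<beta> \<in> Q" using add[OF x(2) y(2)] by (auto simp: affine_lift_def x y)
  moreover have "x + y = (\<alpha> + \<beta>, of_int (r + s))" by (simp add: x y)
  ultimately show "x + y \<in> affine_lift Q" unfolding affine_lift_def by blast
qed

text \<open>
  The gradient of a closed system \<open>\<Delta>\<close> above \<open>affine_lift Q\<close> is closed and contains \<open>Q\<close>, so it is \<open>Q\<close>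
  or \<open>R\<close>. It is not \<open>R\<close>: over a root of \<open>Q\<close> all integers occur in \<open>\<Delta>\<close>, which would force modulus 1
  over every root and \<open>\<Delta> = affine_lift R\<close>.
\<close>

lemma maximal_affine_lift:
  assumes R: "finite_root_system R" and irr: "irreducible_roots (\<bullet>) R"
    and max: "maximal_closed_subroot_system (\<bullet>) R Q"
  shows "maximal_closed_subroot_system affine_form (affine_lift R) (affine_lift Q)"
  unfolding maximal_closed_subroot_system_def
proof (intro conjI allI impI)
  have cl: "closed_subroot_system (\<bullet>) R Q" and QR: "Q \<noteq> R"
    using max by (auto simp: maximal_closed_subroot_system_def)
  then have ne: "Q \<noteq> {}" "Q \<subseteq> R"
    by (auto simp: closed_subroot_system_def subroot_system_def)
  show "closed_subroot_system affine_form (affine_lift R) (affine_lift Q)"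
    by (rule closed_subroot_system_affine_lift[OF R cl])
  show "affine_lift Q \<noteq> affine_lift R" using QR by (simp add: affine_lift_eq_iff)
  fix \<Delta> assume \<Delta>: "closed_subroot_system affine_form (affine_lift R) \<Delta>"
    and sub: "affine_lift Q \<subseteq> \<Delta>" and proper: "\<Delta> \<subset> affine_lift R"
  have "gradient R \<Delta> \<noteq> R"
  proof
    assume "gradient R \<Delta> = R"
    then obtain p m where m: "\<Delta> = shifted_lift R p m"
      using ex_integral_section[OF R \<Delta> irr] by blast
    obtain \<alpha> where a: "\<alpha> \<in> Q" using ne by blast
    then have "(\<alpha>, of_int (p \<alpha> + 1)) \<in> \<Delta>"
      using sub unfolding affine_lift_def by blast
    then obtain r where "real_of_int (p \<alpha> + 1) = of_int (p \<alpha> + r * int m)"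
      unfolding m shifted_lift_def by blast
    then have "1 = r * int m" by linarith
    then have "m = 1" by (metis dvd_triv_right int_dvd_int_iff nat_dvd_1_iff_1 of_nat_1)
    with m proper shifted_lift_1[of R p] show False by auto
  qed
  moreover have "Q \<subseteq> gradient R \<Delta>"
  proof
    fix \<alpha> assume a: "\<alpha> \<in> Q"
    then have "(\<alpha>, of_int 0) \<in> \<Delta>" using sub unfolding affine_lift_def by blast
    with a ne show "\<alpha> \<in> gradient R \<Delta>" unfolding gradient_def by blast
  qed
  moreover have "gradient R \<Delta> \<subseteq> R" by (auto simp: gradient_def)
  ultimately have "gradient R \<Delta> = Q"
    using max closed_subroot_system_gradient[OF R \<Delta>]
    unfolding maximal_closed_subroot_system_def by blast
  with subset_affine_lift_gradient[OF R \<Delta>] sub show "\<Delta> = affine_lift Q" by simp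
qed

lemma eq_affine_lift_gradient:
  assumes R: "finite_root_system R"
    and max: "maximal_closed_subroot_system affine_form (affine_lift R) \<Psi>"
    and proper: "gradient R \<Psi> \<subset> R"
  shows "\<Psi> = affine_lift (gradient R \<Psi>)"
proof -
  have cl: "closed_subroot_system affine_form (affine_lift R) \<Psi>"
    using max by (simp add: maximal_closed_subroot_system_def)
  have "affine_lift (gradient R \<Psi>) \<subset> affine_lift R"
    using proper by (simp add: psubset_eq affine_lift_mono_iff affine_lift_eq_iff)
  then show ?thesis
    using max subset_affine_lift_gradient[OF R cl]
      closed_subroot_system_affine_lift[OF R closed_subroot_system_gradient[OF R cl]]
    unfolding maximal_closed_subroot_system_def by blast
qed

section \<open>Affine types\<close>

text \<open>
  Both comparisons of types below move a decomposition into components along a map \<open>\<phi>\<close> of sets of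
  roots: the image under an isometry, and the affine lift.
\<close>

lemma componentwise_type_transfer:
  assumes type: "componentwise_type B T \<Psi> M"
    and inj: "inj \<phi>" and Un: "\<And>\<C>. \<Union> (\<phi> ` \<C>) = \<phi> (\<Union> \<C>)"
    and orth: "\<And>P Q. orthogonal_sets B P Q \<Longrightarrow> orthogonal_sets B' (\<phi> P) (\<phi> Q)"
    and irr: "\<And>C X. T C X \<Longrightarrow> irreducible_roots B C \<Longrightarrow> irreducible_roots B' (\<phi> C)"
    and comp: "\<And>C X. T C X \<Longrightarrow> T' (\<phi> C) (g X)"
  shows "componentwise_type B' T' (\<phi> \<Psi>) (image_mset g M)"
proof -
  obtain \<C> t where C: "finite \<C>" "\<Union>\<C> = \<Psi>" "pairwise (orthogonal_sets B) \<C>"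
      "\<And>C. C \<in> \<C> \<Longrightarrow> irreducible_roots B C" "\<And>C. C \<in> \<C> \<Longrightarrow> T C (t C)"
    and M: "M = image_mset t (mset_set \<C>)"
    using type unfolding componentwise_type_def by metis
  have inv: "inv \<phi> (\<phi> C) = C" for C using inj by simp
  have "image_mset (g \<circ> t \<circ> inv \<phi>) (mset_set (\<phi> ` \<C>)) =
      image_mset (g \<circ> t \<circ> inv \<phi>) (image_mset \<phi> (mset_set \<C>))"
    using image_mset_mset_set[OF inj_on_subset[OF inj subset_UNIV], of \<C>] by simp
  also have "\<dots> = image_mset g M"
    by (simp add: M multiset.map_comp comp_def inv)
  finally have "image_mset g M = image_mset (g \<circ> t \<circ> inv \<phi>) (mset_set (\<phi> ` \<C>))" ..
  moreover have "finite (\<phi> ` \<C>)" using C(1) by simp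
  moreover have "\<Union> (\<phi> ` \<C>) = \<phi> \<Psi>" using Un C(2) by simp
  moreover have "pairwise (orthogonal_sets B') (\<phi> ` \<C>)"
    using C(3) by (intro pairwise_imageI orth) (auto dest: pairwiseD)
  moreover have "\<forall>D\<in>\<phi> ` \<C>. irreducible_roots B' D \<and> T' D ((g \<circ> t \<circ> inv \<phi>) D)"
    using irr[OF C(5) C(4)] comp[OF C(5)] by (auto simp: inv)
  ultimately show ?thesis
    unfolding componentwise_type_def
    by (intro exI[of _ "\<phi> ` \<C>"] exI[of _ "g \<circ> t \<circ> inv \<phi>"] conjI)
qed

lemma irreducible_roots_image:
  assumes irr: "irreducible_roots B C" and B: "\<And>x y. x \<in> C \<Longrightarrow> y \<in> C \<Longrightarrow> B' (f x) (f y) = B x y"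
  shows "irreducible_roots B' (f ` C)"
  unfolding irreducible_roots_def
proof (intro conjI notI)
  assume "\<exists>P Q. P \<noteq> {} \<and> Q \<noteq> {} \<and> P \<inter> Q = {} \<and> P \<union> Q = f ` C \<and> orthogonal_sets B' P Q"
  then obtain P Q where PQ: "P \<noteq> {}" "Q \<noteq> {}" "P \<inter> Q = {}" "P \<union> Q = f ` C"
    and orth: "orthogonal_sets B' P Q" by blast
  let ?P = "C \<inter> f -` P" and ?Q = "C \<inter> f -` Q"
  have "orthogonal_sets B ?P ?Q"
    unfolding orthogonal_sets_def
  proof (intro ballI)
    fix x y assume "x \<in> ?P" "y \<in> ?Q"
    then show "B x y = 0"
      using orth B[of x y] by (simp add: orthogonal_sets_def)
  qed
  moreover have "P \<subseteq> f ` C" "Q \<subseteq> f ` C" using PQ(4) by auto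
  then have "?P \<noteq> {}" "?Q \<noteq> {}" using PQ(1,2) by fastforce+
  moreover have "?P \<inter> ?Q = {}" using PQ(3) by auto
  moreover have "?P \<union> ?Q = C" using PQ(4) by auto
  ultimately have "\<exists>P Q. P \<noteq> {} \<and> Q \<noteq> {} \<and> P \<inter> Q = {} \<and> P \<union> Q = C \<and> orthogonal_sets B P Q"
    by (intro exI[of _ ?P] exI[of _ ?Q] conjI)
  with irr show False
    unfolding irreducible_roots_def by (elim conjE notE)
qed (use irr in \<open>auto simp: irreducible_roots_def\<close>)

lemma irreducible_affine_type_image:
  fixes f f' :: "'a::euclidean_space \<times> real \<Rightarrow> 'a \<times> real"
  assumes f: "linear f" and f': "linear f'" and inv: "\<And>x. f' (f x) = x"
    and form: "\<And>x y. affine_form (f x) (f y) = affine_form x y"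
    and type: "irreducible_affine_type \<Psi> X"
  shows "irreducible_affine_type (f ` \<Psi>) X"
proof -
  obtain S where S: "real_affine_roots (fst X) (snd X) S" and iso: "affine_roots_iso \<Psi> S"
    using type unfolding irreducible_affine_type_def by blast
  obtain g where g: "linear g" and bij: "bij_betw g (span \<Psi>) (span S)" and gS: "g ` \<Psi> = S"
    and cart: "\<forall>\<alpha>\<in>\<Psi>. \<forall>\<beta>\<in>\<Psi>. cartan_int affine_form (g \<beta>) (g \<alpha>) = cartan_int affine_form \<beta> \<alpha>"
    using iso unfolding affine_roots_iso_def by (elim exE conjE)
  have "bij_betw f' (span (f ` \<Psi>)) (span \<Psi>)"
    unfolding linear_span_image[OF f]
    by (rule bij_betw_byWitness[where f' = f]) (use inv in auto)
  then have "bij_betw (g \<circ> f') (span (f ` \<Psi>)) (span S)"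
    using bij by (rule bij_betw_trans)
  moreover have "linear (g \<circ> f')" using f' g by (rule linear_compose)
  moreover have "(g \<circ> f') ` f ` \<Psi> = S" using gS inv by (simp add: image_image)
  moreover have "cartan_int affine_form (f x) (f y) = cartan_int affine_form x y" for x y
    unfolding cartan_int_def form ..
  then have "\<forall>\<alpha>\<in>f ` \<Psi>. \<forall>\<beta>\<in>f ` \<Psi>. cartan_int affine_form ((g \<circ> f') \<beta>) ((g \<circ> f') \<alpha>) =
      cartan_int affine_form \<beta> \<alpha>"
    using cart inv by (simp del: cartan_int_affine_form)
  ultimately have "affine_roots_iso (f ` \<Psi>) S"
    unfolding affine_roots_iso_def by (intro exI[of _ "g \<circ> f'"] conjI)
  with S show ?thesis
    unfolding irreducible_affine_type_def by blast
qed

lemma has_affine_type_image: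
  fixes f f' :: "'a::euclidean_space \<times> real \<Rightarrow> 'a \<times> real"
  assumes f: "linear f" and f': "linear f'" and inv: "\<And>x. f' (f x) = x"
    and form: "\<And>x y. affine_form (f x) (f y) = affine_form x y"
    and type: "has_affine_type \<Psi> M"
  shows "has_affine_type (f ` \<Psi>) M"
proof -
  have "inj f" using inv by (rule inj_on_inverseI)
  have "componentwise_type affine_form irreducible_affine_type (f ` \<Psi>) (image_mset id M)"
  proof (rule componentwise_type_transfer[where \<phi> = "(`) f" and g = id])
    show "componentwise_type affine_form irreducible_affine_type \<Psi> M"
      using type by (simp add: has_affine_type_def)
    show "inj ((`) f)"
      using \<open>inj f\<close> by (intro injI) (simp add: inj_image_eq_iff)
    show "irreducible_affine_type (f ` C) (id X)" if "irreducible_affine_type C X" for C X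
      using irreducible_affine_type_image[OF f f' inv form that] by simp
  qed (auto simp: orthogonal_sets_def form intro: irreducible_roots_image)
  then show ?thesis by (simp add: has_affine_type_def)
qed

text \<open>
  The linear map \<open>u\<close> shears along \<open>\<delta>\<close> by \<open>f\<close> and stretches \<open>\<delta>\<close> by \<open>n\<close>. As \<open>\<delta>\<close> is in the radical of
  the form, this is an isometry, with inverse \<open>w\<close>.
\<close>

lemma has_affine_type_shifted_lift:
  assumes f: "linear f" and fp: "\<And>\<alpha>. \<alpha> \<in> R \<Longrightarrow> f \<alpha> = real_of_int (p \<alpha>)" and n: "n > 0"
  shows "has_affine_type (shifted_lift R p n) M \<longleftrightarrow> has_affine_type (affine_lift R) M"
proof -
  define u where "u x = (fst x, f (fst x) + real n * snd x)" for x :: "'a \<times> real"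
  define w where "w x = (fst x, (snd x - f (fst x)) / real n)" for x :: "'a \<times> real"
  have lin: "linear u" "linear w"
    unfolding u_def w_def using f
    by (auto intro!: linearI simp: linear_add linear_cmul algebra_simps diff_divide_distrib add_divide_distrib)
  have inv: "w (u x) = x" "u (w x) = x" for x
    using n by (simp_all add: u_def w_def)
  have form: "affine_form (u x) (u y) = affine_form x y" "affine_form (w x) (w y) = affine_form x y" for x y
    by (simp_all add: u_def w_def affine_form_def)
  have u: "u (\<alpha>, of_int r) = (\<alpha>, of_int (p \<alpha> + r * int n))" if "\<alpha> \<in> R" for \<alpha> r
    using fp[OF that] by (simp add: u_def)
  have im: "u ` affine_lift R = shifted_lift R p n"
  proof (intro equalityI subsetI)
    fix x assume "x \<in> u ` affine_lift R"
    then obtain \<alpha> r where "\<alpha> \<in> R" "x = u (\<alpha>, of_int r)" by (auto simp: affine_lift_def)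
    then show "x \<in> shifted_lift R p n" using u unfolding shifted_lift_def by blast
  next
    fix x assume "x \<in> shifted_lift R p n"
    then obtain \<alpha> r where a: "\<alpha> \<in> R" "x = u (\<alpha>, of_int r)"
      using u unfolding shifted_lift_def by (elim CollectE exE conjE) metis
    then have "(\<alpha>, of_int r) \<in> affine_lift R" unfolding affine_lift_def by blast
    with a show "x \<in> u ` affine_lift R" by blast
  qed
  have "w ` shifted_lift R p n = affine_lift R"
    unfolding im[symmetric] by (simp add: image_image inv)
  with im show ?thesis
    using has_affine_type_image[OF lin(1,2) inv(1) form(1), of "affine_lift R" M]
      has_affine_type_image[OF lin(2,1) inv(2) form(2), of "shifted_lift R p n" M]
    by auto
qed

text \<open>
  An orthogonal splitting of the lift projects to one of \<open>C\<close>. The projections are disjoint because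
  a common root would be orthogonal to itself.
\<close>

lemma irreducible_roots_affine_lift:
  assumes "0 \<notin> C" and irr: "irreducible_roots (\<bullet>) C"
  shows "irreducible_roots affine_form (affine_lift C)"
  unfolding irreducible_roots_def
proof (intro conjI notI)
  have ne: "C \<noteq> {}" using irr by (auto simp: irreducible_roots_def)
  then show "affine_lift C = {} \<Longrightarrow> False" by (auto simp: affine_lift_def)
  assume "\<exists>P Q. P \<noteq> {} \<and> Q \<noteq> {} \<and> P \<inter> Q = {} \<and> P \<union> Q = affine_lift C \<and> orthogonal_sets affine_form P Q"
  then obtain P Q where PQ: "P \<noteq> {}" "Q \<noteq> {}" "P \<union> Q = affine_lift C"
    and orth: "orthogonal_sets affine_form P Q" by blast
  have "orthogonal_sets (\<bullet>) (fst ` P) (fst ` Q)"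
    using orth by (auto simp: orthogonal_sets_def affine_form_def)
  moreover have "fst ` P \<union> fst ` Q = C"
    unfolding image_Un[symmetric] PQ(3) by (force simp: affine_lift_def image_iff)
  moreover have "fst ` P \<inter> fst ` Q = {}"
  proof (rule ccontr)
    assume "fst ` P \<inter> fst ` Q \<noteq> {}"
    then obtain \<alpha> where a: "\<alpha> \<in> fst ` P" "\<alpha> \<in> fst ` Q" by blast
    then have "\<alpha> \<bullet> \<alpha> = 0" using calculation(1) unfolding orthogonal_sets_def by blast
    with a calculation(2) assms(1) show False by auto
  qed
  ultimately have "\<exists>P Q. P \<noteq> {} \<and> Q \<noteq> {} \<and> P \<inter> Q = {} \<and> P \<union> Q = C \<and> orthogonal_sets (\<bullet>) P Q"
    using PQ(1,2) by (intro exI[of _ "fst ` P"] exI[of _ "fst ` Q"] conjI) simp_all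
  with irr show False
    unfolding irreducible_roots_def by (elim conjE notE)
qed

lemma irreducible_affine_type_affine_lift:
  assumes "irreducible_finite_type C X"
  shows "irreducible_affine_type (affine_lift C) (X, 1)"
  unfolding irreducible_affine_type_def affine_roots_iso_def
  using real_affine_roots.untwisted[OF assms] by (intro exI[of _ "affine_lift C"] conjI exI[of _ "\<lambda>x. x"])
    (auto intro: linear_ident simp: bij_betw_def)

lemma has_affine_type_affine_lift:
  assumes "has_finite_type Q M"
  shows "has_affine_type (affine_lift Q) (image_mset (\<lambda>X. (X, 1)) M)"
  using assms unfolding has_affine_type_def has_finite_type_def
proof (rule componentwise_type_transfer)
  show "inj affine_lift" by (intro injI) (simp add: affine_lift_eq_iff)
  show "\<Union> (affine_lift ` \<C>) = affine_lift (\<Union> \<C>)" for \<C> :: "'a set set"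
    by (force simp: affine_lift_def)
  show "irreducible_roots affine_form (affine_lift C)"
    if "irreducible_finite_type C X" "irreducible_roots (\<bullet>) C" for C :: "'a set" and X
    using that by (intro irreducible_roots_affine_lift)
      (auto simp: irreducible_finite_type_def finite_root_system_def)
  show "orthogonal_sets affine_form (affine_lift P) (affine_lift Q)"
    if "orthogonal_sets (\<bullet>) P Q" for P Q :: "'a set"
    using that by (auto simp: orthogonal_sets_def affine_lift_def affine_form_def)
qed (rule irreducible_affine_type_affine_lift)

section \<open>The classification\<close>

theorem theorem4p2p1:
  fixes \<Phi>\<^sub>0 :: "'a::euclidean_space set"
  assumes "finite_root_system \<Phi>\<^sub>0" and "irreducible_roots (\<bullet>) \<Phi>\<^sub>0"
  shows
    "(\<forall>\<Psi>. maximal_closed_subroot_system affine_form (affine_lift \<Phi>\<^sub>0) \<Psi> \<longrightarrow>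
          gradient \<Phi>\<^sub>0 \<Psi> = \<Phi>\<^sub>0 \<longrightarrow>
          (\<exists>p n. Z_linear_on (gradient \<Phi>\<^sub>0 \<Psi>) p \<and> reflection_compatible (gradient \<Phi>\<^sub>0 \<Psi>) p \<and>
                 prime n \<and> \<Psi> = shifted_lift (gradient \<Phi>\<^sub>0 \<Psi>) p n) \<and>
          (\<forall>M. has_affine_type \<Psi> M \<longleftrightarrow> has_affine_type (affine_lift \<Phi>\<^sub>0) M)) \<and>
     (\<forall>p n. Z_linear_on \<Phi>\<^sub>0 p \<longrightarrow> reflection_compatible \<Phi>\<^sub>0 p \<longrightarrow> prime n \<longrightarrow>
          maximal_closed_subroot_system affine_form (affine_lift \<Phi>\<^sub>0) (shifted_lift \<Phi>\<^sub>0 p n) \<and>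
          (\<forall>M. has_affine_type (shifted_lift \<Phi>\<^sub>0 p n) M \<longleftrightarrow> has_affine_type (affine_lift \<Phi>\<^sub>0) M)) \<and>
     (\<forall>\<Psi>. maximal_closed_subroot_system affine_form (affine_lift \<Phi>\<^sub>0) \<Psi> \<longrightarrow>
          gradient \<Phi>\<^sub>0 \<Psi> \<subset> \<Phi>\<^sub>0 \<longrightarrow>
          maximal_closed_subroot_system (\<bullet>) \<Phi>\<^sub>0 (gradient \<Phi>\<^sub>0 \<Psi>) \<longrightarrow>
          \<Psi> = affine_lift (gradient \<Phi>\<^sub>0 \<Psi>)) \<and>
     (\<forall>\<Psi>\<^sub>0. maximal_closed_subroot_system (\<bullet>) \<Phi>\<^sub>0 \<Psi>\<^sub>0 \<longrightarrow>
          maximal_closed_subroot_system affine_form (affine_lift \<Phi>\<^sub>0) (affine_lift \<Psi>\<^sub>0) \<and>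
          (\<forall>M. has_finite_type \<Psi>\<^sub>0 M \<longrightarrow>
               has_affine_type (affine_lift \<Psi>\<^sub>0) (image_mset (\<lambda>X. (X, 1)) M)))"
proof (intro conjI allI impI)
  fix \<Psi> assume max: "maximal_closed_subroot_system affine_form (affine_lift \<Phi>\<^sub>0) \<Psi>"
    and full: "gradient \<Phi>\<^sub>0 \<Psi> = \<Phi>\<^sub>0"
  then have "closed_subroot_system affine_form (affine_lift \<Phi>\<^sub>0) \<Psi>"
    by (simp add: maximal_closed_subroot_system_def)
  then obtain f p n where f: "linear f" and fp: "\<And>\<alpha>. \<alpha> \<in> \<Phi>\<^sub>0 \<Longrightarrow> f \<alpha> = real_of_int (p \<alpha>)"
    and \<Psi>: "\<Psi> = shifted_lift \<Phi>\<^sub>0 p n"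
    using ex_integral_section[OF assms(1) _ assms(2) full] by blast
  have n: "prime n"
    using prime_of_maximal_shifted_lift[OF assms f fp] max \<Psi> by simp
  show "\<exists>p n. Z_linear_on (gradient \<Phi>\<^sub>0 \<Psi>) p \<and> reflection_compatible (gradient \<Phi>\<^sub>0 \<Psi>) p \<and>
      prime n \<and> \<Psi> = shifted_lift (gradient \<Phi>\<^sub>0 \<Psi>) p n"
    unfolding full
    using Z_linear_on_of_linear[OF f fp] reflection_compatible_of_linear[OF assms(1) f fp] n \<Psi> by blast
  show "has_affine_type \<Psi> M \<longleftrightarrow> has_affine_type (affine_lift \<Phi>\<^sub>0) M" for M
    unfolding \<Psi> using has_affine_type_shifted_lift[OF f fp] n prime_gt_0_nat by blast
next
  fix p n assume "Z_linear_on \<Phi>\<^sub>0 p" and n: "prime (n::nat)"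
  then obtain f where f: "linear f" and fp: "\<And>\<alpha>. \<alpha> \<in> \<Phi>\<^sub>0 \<Longrightarrow> f \<alpha> = real_of_int (p \<alpha>)"
    using Z_linear_on_extends_linear[OF assms] by blast
  show "maximal_closed_subroot_system affine_form (affine_lift \<Phi>\<^sub>0) (shifted_lift \<Phi>\<^sub>0 p n)"
    by (rule maximal_shifted_lift[OF assms f fp n])
  show "has_affine_type (shifted_lift \<Phi>\<^sub>0 p n) M \<longleftrightarrow> has_affine_type (affine_lift \<Phi>\<^sub>0) M" for M
    using has_affine_type_shifted_lift[OF f fp] n prime_gt_0_nat by blast
next
  show "\<Psi> = affine_lift (gradient \<Phi>\<^sub>0 \<Psi>)"
    if "maximal_closed_subroot_system affine_form (affine_lift \<Phi>\<^sub>0) \<Psi>" "gradient \<Phi>\<^sub>0 \<Psi> \<subset> \<Phi>\<^sub>0" for \<Psi>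
    by (rule eq_affine_lift_gradient[OF assms(1) that])
next
  show "maximal_closed_subroot_system affine_form (affine_lift \<Phi>\<^sub>0) (affine_lift \<Psi>\<^sub>0)"
    if "maximal_closed_subroot_system (\<bullet>) \<Phi>\<^sub>0 \<Psi>\<^sub>0" for \<Psi>\<^sub>0
    by (rule maximal_affine_lift[OF assms that])
  show "has_affine_type (affine_lift \<Psi>\<^sub>0) (image_mset (\<lambda>X. (X, 1)) M)"
    if "has_finite_type \<Psi>\<^sub>0 M" for \<Psi>\<^sub>0 :: "'a set" and M
    by (rule has_affine_type_affine_lift[OF that])
qed

end
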